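(* Let $(M,\sigma)$ be a symplectic manifold and let $w$ be the Poisson bivector field of $\sigma$, defined by $\sharp_w\circ\flat_\sigma=-Id$. For each $\epsilon\in\{-1,1,0\}$, there exists a bijective correspondence between the Poisson structures $W$ on $M$ that are compatible with $w$ and the generalized c.p.s. structures of $M$ (with $\Phi^2=\epsilon Id$) which have the form $\sigma$ in their matrix representation. This correspondence is given by $$W\mapsto\Phi_W=\begin{pmatrix}B&\sharp_\kappa\\ \flat_\sigma&-{}^tB\end{pmatrix}=\begin{pmatrix}-\sharp_W\circ\flat_\sigma&-\epsilon\sharp_w-\sharp_W\circ\flat_\sigma\circ\sharp_W\\ \flat_\sigma&\flat_\sigma\circ\sharp_W\end{pmatrix}.$$
   Context: All objects are $C^\infty$. $\Gamma$ denotes spaces of sections. $T^{big}M=TM\oplus T^*M$ carries the metric $g((X,\alpha),(Y,\beta))=\frac12(\alpha(Y)+\beta(X))$ and the Courant bracket $[(X,\alpha),(Y,\beta)]=([X,Y],\,L_X\beta-L_Y\alpha+\frac12 d(\alpha(Y)-\beta(X)))$. For a bivector field $\pi$, $\sharp_\pi\alpha=i(\alpha)\pi$, i.e. $\beta(\sharp_\pi\alpha)=\pi(\alpha,\beta)$; for a $2$-form $\sigma$, $\flat_\sigma X=i(X)\sigma$; ${}^tA$ denotes the transpose, ${}^tA\,\alpha=\alpha\circ A$. A generalized almost c.p.s. structure on $M$ is $\Phi\in\Gamma(End\,T^{big}M)$ with $g(\mathcal X,\Phi\mathcal Y)+g(\Phi\mathcal X,\mathcal Y)=0$ and $\Phi^2=\epsilon\,Id$,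 where $\epsilon=-1$ (complex), $\epsilon=1$ (paracomplex) or $\epsilon=0$ (subtangent). Such a $\Phi$ has the matrix representation $\begin{pmatrix}A&\sharp_\pi\\ \flat_\sigma&-{}^tA\end{pmatrix}$ acting on columns $(X,\alpha)^t$, for a $(1,1)$-tensor field $A$, a bivector field $\pi$ and a $2$-form $\sigma$ satisfying $A^2=\epsilon Id-\sharp_\pi\circ\flat_\sigma$, $\pi(\alpha\circ A,\beta)=\pi(\alpha,\beta\circ A)$, $\sigma(AX,Y)=\sigma(X,AY)$. $\Phi$ is integrable, and is then called a generalized c.p.s. structure, if $[\Phi\mathcal X,\Phi\mathcal Y]-\Phi[\mathcal X,\Phi\mathcal Y]-\Phi[\Phi\mathcal X,\mathcal Y]+\Phi^2[\mathcal X,\mathcal Y]=0$ for all sections $\mathcal X,\mathcal Y$ of $T^{big}M$ (Courant brackets). Two Poisson structures $w,W$ are compatible if their Schouten-Nijenhuis bracket $[w,W]$ vanishes. *)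

theory Defs
  imports "HOL-Analysis.Analysis" "HOL-Library.Function_Algebras"
begin

(* Fields are treated as modules of sections over the algebra of smooth functions, as in
   Helgason, "Differential Geometry, Lie Groups, and Symmetric Spaces", Ch. I: vector fields are
   the derivations of that algebra, one-forms are the dual module of the vector fields, and the
   other tensor fields are multilinear (or linear) over the smooth functions.

   HOL functions are total, so every such object is required to vanish outside the module on
   which it lives.  This makes HOL equality coincide with equality of fields.

   Sums, products and 0 of functions are the pointwise ones of Function_Algebras. *)

section \<open>Smooth manifolds\<close>

primrec C_k_on :: "nat \<Rightarrow> 'a::real_normed_vector set \<Rightarrow> ('a \<Rightarrow> 'b::real_normed_vector) \<Rightarrow> bool"
  where
    "C_k_on 0 S f \<longleftrightarrow> continuous_on S f"
  | "C_k_on (Suc k) S f \<longleftrightarrow>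
       (\<exists>f'. (\<forall>x\<in>S. (f has_derivative f' x) (at x)) \<and> (\<forall>v. C_k_on k S (\<lambda>x. f' x v)))"

(* Only used for open S in a finite-dimensional domain. *)
definition smooth_on :: "'a::real_normed_vector set \<Rightarrow> ('a \<Rightarrow> 'b::real_normed_vector) \<Rightarrow> bool"
  where "smooth_on S f \<longleftrightarrow> (\<forall>k. C_k_on k S f)"

type_synonym ('m, 'e) atlas = "('m set \<times> ('m \<Rightarrow> 'e)) set"

(* The model space is a finite-dimensional normed space rather than a type of class
   euclidean_space, because the latter excludes dimension 0.  The atlas need not be maximal. *)
definition smooth_manifold ::
    "('m::{t2_space,second_countable_topology}, 'e::real_normed_vector) atlas \<Rightarrow> bool"
  where "smooth_manifold A \<longleftrightarrow>
    (\<exists>B::'e set. finite B \<and> span B = UNIV) \<and>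
    (\<Union>(U, \<phi>)\<in>A. U) = UNIV \<and>
    (\<forall>(U, \<phi>)\<in>A. open U \<and> open (\<phi> ` U) \<and> homeomorphism U (\<phi> ` U) \<phi> (inv_into U \<phi>)) \<and>
    (\<forall>(U, \<phi>)\<in>A. \<forall>(V, \<psi>)\<in>A. smooth_on (\<phi> ` (U \<inter> V)) (\<psi> \<circ> inv_into U \<phi>))"

definition smooth_functions ::
    "('m, 'e::real_normed_vector) atlas \<Rightarrow> ('m \<Rightarrow> real) set"
  where "smooth_functions A = {f. \<forall>(U, \<phi>)\<in>A. smooth_on (\<phi> ` U) (f \<circ> inv_into U \<phi>)}"

section \<open>Vector fields, forms and bivector fields\<close>

type_synonym 'm vfield = "('m \<Rightarrow> real) \<Rightarrow> ('m \<Rightarrow> real)"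
type_synonym 'm form1 = "'m vfield \<Rightarrow> ('m \<Rightarrow> real)"
type_synonym 'm form2 = "'m vfield \<Rightarrow> 'm vfield \<Rightarrow> ('m \<Rightarrow> real)"
type_synonym 'm bivector = "'m form1 \<Rightarrow> 'm form1 \<Rightarrow> ('m \<Rightarrow> real)"
type_synonym 'm tensor11 = "'m vfield \<Rightarrow> 'm vfield"

(* Multiplication of a vector field or of a one-form by a function. *)
definition smul :: "('m \<Rightarrow> real) \<Rightarrow> ('x \<Rightarrow> 'm \<Rightarrow> real) \<Rightarrow> 'x \<Rightarrow> 'm \<Rightarrow> real"
  where "smul f X = (\<lambda>x. f * X x)"

definition const_fun :: "real \<Rightarrow> 'm \<Rightarrow> real"
  where "const_fun c = (\<lambda>p. c)"

definition vector_fields :: "('m, 'e::real_normed_vector) atlas \<Rightarrow> 'm vfield set"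
  where "vector_fields A = {X.
    (\<forall>f\<in>smooth_functions A. X f \<in> smooth_functions A) \<and>
    (\<forall>f\<in>smooth_functions A. \<forall>g\<in>smooth_functions A. X (f + g) = X f + X g) \<and>
    (\<forall>c. \<forall>f\<in>smooth_functions A. X (const_fun c * f) = const_fun c * X f) \<and>
    (\<forall>f\<in>smooth_functions A. \<forall>g\<in>smooth_functions A. X (f * g) = f * X g + g * X f) \<and>
    (\<forall>f. f \<notin> smooth_functions A \<longrightarrow> X f = 0)}"

(* Dual of a module S of vector fields or of one-forms. *)
definition dual_module ::
    "('m, 'e::real_normed_vector) atlas \<Rightarrow> ('x \<Rightarrow> 'm \<Rightarrow> real) set \<Rightarrow>
     (('x \<Rightarrow> 'm \<Rightarrow> real) \<Rightarrow> 'm \<Rightarrow> real) set"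
  where "dual_module A S = {\<alpha>.
    (\<forall>X\<in>S. \<alpha> X \<in> smooth_functions A) \<and>
    (\<forall>X\<in>S. \<forall>Y\<in>S. \<alpha> (X + Y) = \<alpha> X + \<alpha> Y) \<and>
    (\<forall>f\<in>smooth_functions A. \<forall>X\<in>S. \<alpha> (smul f X) = f * \<alpha> X) \<and>
    (\<forall>X. X \<notin> S \<longrightarrow> \<alpha> X = 0)}"

(* Linearity in the second argument and skew-symmetry give linearity in the first. *)
definition alternating_forms ::
    "('m, 'e::real_normed_vector) atlas \<Rightarrow> ('x \<Rightarrow> 'm \<Rightarrow> real) set \<Rightarrow>
     (('x \<Rightarrow> 'm \<Rightarrow> real) \<Rightarrow> ('x \<Rightarrow> 'm \<Rightarrow> real) \<Rightarrow> 'm \<Rightarrow> real) set"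
  where "alternating_forms A S = {\<sigma>.
    (\<forall>X\<in>S. \<sigma> X \<in> dual_module A S) \<and>
    (\<forall>X\<in>S. \<forall>Y\<in>S. \<sigma> X Y = - \<sigma> Y X) \<and>
    (\<forall>X. X \<notin> S \<longrightarrow> \<sigma> X = 0)}"

definition one_forms :: "('m, 'e::real_normed_vector) atlas \<Rightarrow> 'm form1 set"
  where "one_forms A = dual_module A (vector_fields A)"

definition two_forms :: "('m, 'e::real_normed_vector) atlas \<Rightarrow> 'm form2 set"
  where "two_forms A = alternating_forms A (vector_fields A)"

definition bivector_fields :: "('m, 'e::real_normed_vector) atlas \<Rightarrow> 'm bivector set"
  where "bivector_fields A = alternating_forms A (one_forms A)"

definition tensors11 :: "('m, 'e::real_normed_vector) atlas \<Rightarrow> 'm tensor11 set"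
  where "tensors11 A = {B.
    (\<forall>X\<in>vector_fields A. B X \<in> vector_fields A) \<and>
    (\<forall>X\<in>vector_fields A. \<forall>Y\<in>vector_fields A. B (X + Y) = B X + B Y) \<and>
    (\<forall>f\<in>smooth_functions A. \<forall>X\<in>vector_fields A. B (smul f X) = smul f (B X)) \<and>
    (\<forall>X. X \<notin> vector_fields A \<longrightarrow> B X = 0)}"

definition transpose11 :: "'m tensor11 \<Rightarrow> 'm form1 \<Rightarrow> 'm form1"
  where "transpose11 B \<alpha> = (\<lambda>X. \<alpha> (B X))"

definition flat :: "'m form2 \<Rightarrow> 'm vfield \<Rightarrow> 'm form1"
  where "flat \<sigma> X = (\<lambda>Y. \<sigma> X Y)"

(* A vector field X with \<beta>(X) = \<pi>(\<alpha>, \<beta>) for all one-forms \<beta> exists because the module of vector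
   fields on a manifold is reflexive; it is unique because \<beta> may be any df. *)
definition sharp ::
    "('m, 'e::real_normed_vector) atlas \<Rightarrow> 'm bivector \<Rightarrow> 'm form1 \<Rightarrow> 'm vfield"
  where "sharp A \<pi> \<alpha> = (if \<alpha> \<in> one_forms A
     then THE X. X \<in> vector_fields A \<and> (\<forall>\<beta>\<in>one_forms A. \<beta> X = \<pi> \<alpha> \<beta>)
     else 0)"

section \<open>Differential operators\<close>

definition lie_bracket :: "'m vfield \<Rightarrow> 'm vfield \<Rightarrow> 'm vfield"
  where "lie_bracket X Y = (\<lambda>f. X (Y f) - Y (X f))"

definition differential ::
    "('m, 'e::real_normed_vector) atlas \<Rightarrow> ('m \<Rightarrow> real) \<Rightarrow> 'm form1"
  where "differential A f = (\<lambda>X. if X \<in> vector_fields A then X f else 0)"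

definition lie_derivative ::
    "('m, 'e::real_normed_vector) atlas \<Rightarrow> 'm vfield \<Rightarrow> 'm form1 \<Rightarrow> 'm form1"
  where "lie_derivative A X \<beta> =
    (\<lambda>Y. if Y \<in> vector_fields A then X (\<beta> Y) - \<beta> (lie_bracket X Y) else 0)"

definition closed_form2 :: "('m, 'e::real_normed_vector) atlas \<Rightarrow> 'm form2 \<Rightarrow> bool"
  where "closed_form2 A \<sigma> \<longleftrightarrow>
    (\<forall>X\<in>vector_fields A. \<forall>Y\<in>vector_fields A. \<forall>Z\<in>vector_fields A.
       X (\<sigma> Y Z) + Y (\<sigma> Z X) + Z (\<sigma> X Y)
       - \<sigma> (lie_bracket X Y) Z - \<sigma> (lie_bracket Y Z) X - \<sigma> (lie_bracket Z X) Y = 0)"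

(* Nondegeneracy: \<flat>\<^sub>\<sigma> is an isomorphism from the tangent to the cotangent bundle, stated on
   sections. *)
definition symplectic_form :: "('m, 'e::real_normed_vector) atlas \<Rightarrow> 'm form2 \<Rightarrow> bool"
  where "symplectic_form A \<sigma> \<longleftrightarrow>
    \<sigma> \<in> two_forms A \<and> closed_form2 A \<sigma> \<and>
    bij_betw (flat \<sigma>) (vector_fields A) (one_forms A)"

(* The Schouten-Nijenhuis bracket of two bivector fields, as a trivector field, i.e. evaluated on
   three one-forms.  The formula is the polarization of
     [P,P](\<alpha>,\<beta>,\<gamma>) = 2 \<gamma>(\<sharp>\<^sub>P{\<alpha>,\<beta>} - [\<sharp>\<^sub>P\<alpha>,\<sharp>\<^sub>P\<beta>]),
     {\<alpha>,\<beta>} = L_{\<sharp>\<^sub>P\<alpha>} \<beta> - L_{\<sharp>\<^sub>P\<beta>} \<alpha> - d(P(\<alpha>,\<beta>)),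
   with the Lie derivatives written out.  See schouten_exact below for its values on exact
   forms, which determine a trivector field. *)
definition schouten ::
    "('m, 'e::real_normed_vector) atlas \<Rightarrow> 'm bivector \<Rightarrow> 'm bivector \<Rightarrow>
     'm form1 \<Rightarrow> 'm form1 \<Rightarrow> 'm form1 \<Rightarrow> ('m \<Rightarrow> real)"
  where "schouten A P Q \<alpha> \<beta> \<gamma> = (let
      T = (\<lambda>\<alpha> \<beta> \<gamma>. sharp A P \<alpha> (Q \<beta> \<gamma>) + sharp A Q \<alpha> (P \<beta> \<gamma>)
            - \<alpha> (lie_bracket (sharp A P \<beta>) (sharp A Q \<gamma>))
            - \<alpha> (lie_bracket (sharp A Q \<beta>) (sharp A P \<gamma>)))
    in T \<alpha> \<beta> \<gamma> + T \<beta> \<gamma> \<alpha> + T \<gamma> \<alpha> \<beta>)"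

definition schouten_vanishes ::
    "('m, 'e::real_normed_vector) atlas \<Rightarrow> 'm bivector \<Rightarrow> 'm bivector \<Rightarrow> bool"
  where "schouten_vanishes A P Q \<longleftrightarrow>
    (\<forall>\<alpha>\<in>one_forms A. \<forall>\<beta>\<in>one_forms A. \<forall>\<gamma>\<in>one_forms A. schouten A P Q \<alpha> \<beta> \<gamma> = 0)"

definition poisson :: "('m, 'e::real_normed_vector) atlas \<Rightarrow> 'm bivector \<Rightarrow> bool"
  where "poisson A W \<longleftrightarrow> W \<in> bivector_fields A \<and> schouten_vanishes A W W"

definition poisson_bivector_of ::
    "('m, 'e::real_normed_vector) atlas \<Rightarrow> 'm form2 \<Rightarrow> 'm bivector \<Rightarrow> bool"
  where "poisson_bivector_of A \<sigma> w \<longleftrightarrow>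
    w \<in> bivector_fields A \<and> (\<forall>X\<in>vector_fields A. sharp A w (flat \<sigma> X) = - X)"

section \<open>The big tangent bundle\<close>

type_synonym 'm big = "'m vfield \<times> 'm form1"

definition big_sections :: "('m, 'e::real_normed_vector) atlas \<Rightarrow> 'm big set"
  where "big_sections A = vector_fields A \<times> one_forms A"

definition big_metric :: "'m big \<Rightarrow> 'm big \<Rightarrow> ('m \<Rightarrow> real)"
  where "big_metric = (\<lambda>(X, \<alpha>) (Y, \<beta>). const_fun (1/2) * (\<alpha> Y + \<beta> X))"

definition courant_bracket ::
    "('m, 'e::real_normed_vector) atlas \<Rightarrow> 'm big \<Rightarrow> 'm big \<Rightarrow> 'm big"
  where "courant_bracket A = (\<lambda>(X, \<alpha>) (Y, \<beta>).
    (lie_bracket X Y,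
     lie_derivative A X \<beta> - lie_derivative A Y \<alpha>
       + smul (const_fun (1/2)) (differential A (\<alpha> Y - \<beta> X))))"

definition big_endomorphisms ::
    "('m, 'e::real_normed_vector) atlas \<Rightarrow> ('m big \<Rightarrow> 'm big) set"
  where "big_endomorphisms A = {\<Phi>.
    (\<forall>s\<in>big_sections A. \<Phi> s \<in> big_sections A) \<and>
    (\<forall>s\<in>big_sections A. \<forall>t\<in>big_sections A. \<Phi> (s + t) = \<Phi> s + \<Phi> t) \<and>
    (\<forall>f\<in>smooth_functions A. \<forall>s\<in>big_sections A.
       \<Phi> (map_prod (smul f) (smul f) s) = map_prod (smul f) (smul f) (\<Phi> s)) \<and>
    (\<forall>s. s \<notin> big_sections A \<longrightarrow> \<Phi> s = 0)}"

definition generalized_almost_cps ::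
    "('m, 'e::real_normed_vector) atlas \<Rightarrow> real \<Rightarrow> ('m big \<Rightarrow> 'm big) \<Rightarrow> bool"
  where "generalized_almost_cps A \<epsilon> \<Phi> \<longleftrightarrow>
    \<Phi> \<in> big_endomorphisms A \<and>
    (\<forall>s\<in>big_sections A. \<forall>t\<in>big_sections A. big_metric s (\<Phi> t) + big_metric (\<Phi> s) t = 0) \<and>
    (\<forall>s\<in>big_sections A.
       \<Phi> (\<Phi> s) = map_prod (smul (const_fun \<epsilon>)) (smul (const_fun \<epsilon>)) s)"

definition integrable_cps ::
    "('m, 'e::real_normed_vector) atlas \<Rightarrow> ('m big \<Rightarrow> 'm big) \<Rightarrow> bool"
  where "integrable_cps A \<Phi> \<longleftrightarrow>
    (\<forall>s\<in>big_sections A. \<forall>t\<in>big_sections A.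
       courant_bracket A (\<Phi> s) (\<Phi> t) - \<Phi> (courant_bracket A s (\<Phi> t))
       - \<Phi> (courant_bracket A (\<Phi> s) t) + \<Phi> (\<Phi> (courant_bracket A s t)) = 0)"

definition generalized_cps ::
    "('m, 'e::real_normed_vector) atlas \<Rightarrow> real \<Rightarrow> ('m big \<Rightarrow> 'm big) \<Rightarrow> bool"
  where "generalized_cps A \<epsilon> \<Phi> \<longleftrightarrow> generalized_almost_cps A \<epsilon> \<Phi> \<and> integrable_cps A \<Phi>"

(* Set to 0 outside the sections, as required of elements of big_endomorphisms. *)
definition big_matrix ::
    "('m, 'e::real_normed_vector) atlas \<Rightarrow>
     ('m vfield \<Rightarrow> 'm vfield) \<Rightarrow> ('m form1 \<Rightarrow> 'm vfield) \<Rightarrow>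
     ('m vfield \<Rightarrow> 'm form1) \<Rightarrow> ('m form1 \<Rightarrow> 'm form1) \<Rightarrow> 'm big \<Rightarrow> 'm big"
  where "big_matrix A a b c d =
    (\<lambda>(X, \<alpha>). if (X, \<alpha>) \<in> big_sections A then (a X + b \<alpha>, c X + d \<alpha>) else 0)"

definition represented_by ::
    "('m, 'e::real_normed_vector) atlas \<Rightarrow> ('m big \<Rightarrow> 'm big) \<Rightarrow>
     'm tensor11 \<Rightarrow> 'm bivector \<Rightarrow> 'm form2 \<Rightarrow> bool"
  where "represented_by A \<Phi> B \<kappa> \<sigma> \<longleftrightarrow>
    B \<in> tensors11 A \<and> \<kappa> \<in> bivector_fields A \<and> \<sigma> \<in> two_forms A \<and>
    \<Phi> = big_matrix A B (sharp A \<kappa>) (flat \<sigma>) (\<lambda>\<alpha>. - transpose11 B \<alpha>)"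

definition cps_of_poisson ::
    "('m, 'e::real_normed_vector) atlas \<Rightarrow> 'm form2 \<Rightarrow> 'm bivector \<Rightarrow> real \<Rightarrow>
     'm bivector \<Rightarrow> 'm big \<Rightarrow> 'm big"
  where "cps_of_poisson A \<sigma> w \<epsilon> W = big_matrix A
    (\<lambda>X. - sharp A W (flat \<sigma> X))
    (\<lambda>\<alpha>. - smul (const_fun \<epsilon>) (sharp A w \<alpha>) - sharp A W (flat \<sigma> (sharp A W \<alpha>)))
    (flat \<sigma>)
    (\<lambda>\<alpha>. flat \<sigma> (sharp A W \<alpha>))"

section \<open>The Schouten bracket on exact forms\<close>

lemma C_k_on_Suc: "C_k_on (Suc k) S f \<Longrightarrow> C_k_on k S f"
proof (induction k arbitrary: f)
  case 0
  then show ?case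
    unfolding C_k_on.simps by (blast intro: continuous_at_imp_continuous_on has_derivative_continuous)
next
  case (Suc k)
  then show ?case by (metis C_k_on.simps(2))
qed

lemma C_k_on_const: "C_k_on k S (\<lambda>x. c)"
proof (induction k arbitrary: c)
  case (Suc k)
  then show ?case by (auto intro!: exI[of _ "\<lambda>x v. 0"])
qed auto

lemma C_k_on_add: "C_k_on k S f \<Longrightarrow> C_k_on k S g \<Longrightarrow> C_k_on k S (\<lambda>x. f x + g x)"
proof (induction k arbitrary: f g)
  case (Suc k)
  then obtain f' g' where
    "\<forall>x\<in>S. (f has_derivative f' x) (at x)" "\<forall>v. C_k_on k S (\<lambda>x. f' x v)"
    "\<forall>x\<in>S. (g has_derivative g' x) (at x)" "\<forall>v. C_k_on k S (\<lambda>x. g' x v)" by auto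
  then show ?case using Suc.IH
    by (auto intro!: exI[of _ "\<lambda>x v. f' x v + g' x v"] has_derivative_add)
qed (auto intro: continuous_on_add)

lemma C_k_on_mult:
  fixes f g :: "'a::real_normed_vector \<Rightarrow> real"
  shows "C_k_on k S f \<Longrightarrow> C_k_on k S g \<Longrightarrow> C_k_on k S (\<lambda>x. f x * g x)"
proof (induction k arbitrary: f g)
  case (Suc k)
  then obtain f' g' where
    "\<forall>x\<in>S. (f has_derivative f' x) (at x)" "\<forall>v. C_k_on k S (\<lambda>x. f' x v)"
    "\<forall>x\<in>S. (g has_derivative g' x) (at x)" "\<forall>v. C_k_on k S (\<lambda>x. g' x v)" by auto
  moreover have "C_k_on k S f" "C_k_on k S g" using Suc.prems by (blast intro: C_k_on_Suc)+
  ultimately show ?case using Suc.IH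
    by (auto intro!: exI[of _ "\<lambda>x v. f x * g' x v + f' x v * g x"] has_derivative_mult C_k_on_add)
qed (auto intro: continuous_on_mult)

lemma smooth_functions_const: "const_fun c \<in> smooth_functions A"
  by (auto simp: smooth_functions_def smooth_on_def const_fun_def o_def C_k_on_const)

lemma smooth_functions_add:
  "f \<in> smooth_functions A \<Longrightarrow> g \<in> smooth_functions A \<Longrightarrow> f + g \<in> smooth_functions A"
  by (fastforce simp: smooth_functions_def smooth_on_def o_def intro: C_k_on_add)

lemma smooth_functions_mult:
  "f \<in> smooth_functions A \<Longrightarrow> g \<in> smooth_functions A \<Longrightarrow> f * g \<in> smooth_functions A"
  by (fastforce simp: smooth_functions_def smooth_on_def o_def intro: C_k_on_mult)

lemma uminus_fun_eq: "- f = const_fun (- 1) * f"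
  by (simp add: fun_eq_iff const_fun_def)

lemma smooth_functions_uminus: "f \<in> smooth_functions A \<Longrightarrow> - f \<in> smooth_functions A"
  unfolding uminus_fun_eq by (intro smooth_functions_mult smooth_functions_const)

lemma smooth_functions_diff:
  "f \<in> smooth_functions A \<Longrightarrow> g \<in> smooth_functions A \<Longrightarrow> f - g \<in> smooth_functions A"
  using smooth_functions_add[of f A "- g"] smooth_functions_uminus[of g A]
  by (simp add: fun_eq_iff)

lemma vector_fieldsD:
  assumes "X \<in> vector_fields A" "f \<in> smooth_functions A"
  shows "X f \<in> smooth_functions A"
    and "g \<in> smooth_functions A \<Longrightarrow> X (f + g) = X f + X g"
    and "g \<in> smooth_functions A \<Longrightarrow> X (f * g) = f * X g + g * X f"
    and "X (const_fun c * f) = const_fun c * X f"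
    and "X (- f) = - X f"
    and "g \<in> smooth_functions A \<Longrightarrow> X (f - g) = X f - X g"
proof -
  have 1: "X (- f) = - X f" if "f \<in> smooth_functions A" for f
    using assms(1) that unfolding uminus_fun_eq by (simp add: vector_fields_def)
  then show "X (- f) = - X f" using assms by blast
  show "X (f - g) = X f - X g" if "g \<in> smooth_functions A"
  proof -
    have "X (f + (- g)) = X f + X (- g)"
      using assms smooth_functions_uminus[OF that] by (simp add: vector_fields_def del: add_uminus_conv_diff)
    then show ?thesis using 1[OF that] by simp
  qed
qed (use assms in \<open>auto simp: vector_fields_def\<close>)

lemma vector_fields_off: "X \<in> vector_fields A \<Longrightarrow> f \<notin> smooth_functions A \<Longrightarrow> X f = 0"
  by (simp add: vector_fields_def)

lemma zero_smooth: "0 \<in> smooth_functions A"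
  using smooth_functions_const[of 0 A] by (simp add: const_fun_def zero_fun_def)

lemma lie_bracket_vector_field:
  assumes X: "X \<in> vector_fields A" and Y: "Y \<in> vector_fields A"
  shows "lie_bracket X Y \<in> vector_fields A"
proof -
  note V = vector_fieldsD[OF X] vector_fieldsD[OF Y]
  have z: "X 0 = 0" "Y 0 = 0" using V(6,12)[of 0 0] zero_smooth[of A] by auto
  show ?thesis
    unfolding vector_fields_def lie_bracket_def mem_Collect_eq
  proof (intro conjI ballI allI impI)
    fix c f assume "f \<in> smooth_functions A"
    then show "X (Y (const_fun c * f)) - Y (X (const_fun c * f)) =
        const_fun c * (X (Y f) - Y (X f))"
      by (simp only: V right_diff_distrib)
  qed (auto simp: V z smooth_functions_add smooth_functions_mult smooth_functions_diff
        vector_fields_off[OF X] vector_fields_off[OF Y] algebra_simps)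
qed

lemma differential_one_form:
  assumes "f \<in> smooth_functions A"
  shows "differential A f \<in> one_forms A"
proof -
  have "X + Y \<in> vector_fields A" if "X \<in> vector_fields A" "Y \<in> vector_fields A" for X Y
    using that unfolding vector_fields_def
    by (auto simp: smooth_functions_add algebra_simps)
  moreover have "smul h X \<in> vector_fields A"
    if "h \<in> smooth_functions A" "X \<in> vector_fields A" for h X
    using that unfolding vector_fields_def smul_def
    by (auto simp: smooth_functions_mult algebra_simps)
  ultimately show ?thesis
    using assms by (auto simp: one_forms_def dual_module_def differential_def smul_def vector_fieldsD)
qed

(* The first two premises hold for all bivector fields on a manifold, see the comment on sharp. *)
lemma schouten_exact:
  assumes shP: "\<And>\<alpha>. \<alpha> \<in> one_forms A \<Longrightarrow>
      sharp A P \<alpha> \<in> vector_fields A \<and> (\<forall>\<beta>\<in>one_forms A. \<beta> (sharp A P \<alpha>) = P \<alpha> \<beta>)"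
    and shQ: "\<And>\<alpha>. \<alpha> \<in> one_forms A \<Longrightarrow>
      sharp A Q \<alpha> \<in> vector_fields A \<and> (\<forall>\<beta>\<in>one_forms A. \<beta> (sharp A Q \<alpha>) = Q \<alpha> \<beta>)"
    and P: "P \<in> bivector_fields A" and Q: "Q \<in> bivector_fields A"
    and f: "f \<in> smooth_functions A" and g: "g \<in> smooth_functions A"
    and h: "h \<in> smooth_functions A"
  defines "br \<equiv> \<lambda>R u v. R (differential A u) (differential A v)"
  shows "schouten A P Q (differential A f) (differential A g) (differential A h) =
      br P (br Q f g) h + br P (br Q g h) f + br P (br Q h f) g
      + br Q (br P f g) h + br Q (br P g h) f + br Q (br P h f) g"
proof -
  let ?C = "smooth_functions A" and ?d = "differential A"
  have key: "br R u v \<in> ?C \<and> br R u v = - br R v u \<and> sharp A R (?d u) v = br R u v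
      \<and> sharp A R (?d u) \<in> vector_fields A"
    if "R = P \<or> R = Q" "u \<in> ?C" "v \<in> ?C" for R u v
  proof -
    have d: "?d u \<in> one_forms A" "?d v \<in> one_forms A" using that differential_one_form by auto
    have R: "R \<in> bivector_fields A" "sharp A R (?d u) \<in> vector_fields A"
      "?d v (sharp A R (?d u)) = R (?d u) (?d v)"
      using that P Q shP[OF d(1)] shQ[OF d(1)] d(2) by auto
    have "R (?d u) \<in> dual_module A (one_forms A)" "R (?d u) (?d v) = - R (?d v) (?d u)"
      using R(1) d unfolding bivector_fields_def alternating_forms_def by blast+
    moreover from this(1) have "R (?d u) (?d v) \<in> ?C"
      using d unfolding dual_module_def by blast
    ultimately show ?thesis
      using R(2,3) unfolding br_def differential_def by simp
  qed
  have br_neg: "br R (- u) v = - br R u v" if "R = P \<or> R = Q" "u \<in> ?C" "v \<in> ?C" for R u v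
  proof -
    have m: "- u \<in> ?C" using that smooth_functions_uminus by blast
    have "br R (- u) v = - br R v (- u)" using key[OF that(1) m that(3)] by blast
    also have "br R v (- u) = sharp A R (?d v) (- u)" using key[OF that(1,3) m] by simp
    also have "\<dots> = - br R v u"
      using vector_fieldsD(5)[of "sharp A R (?d v)" A u] key[OF that(1,3,2)] that(2) by simp
    also have "- br R v u = br R u v" using key[OF that] by simp
    finally show ?thesis .
  qed
  have lie: "?d u (lie_bracket (sharp A R (?d v)) (sharp A S (?d x))) =
      br R v (br S x u) - br S x (br R v u)"
    if "R = P \<or> R = Q" "S = P \<or> S = Q" "u \<in> ?C" "v \<in> ?C" "x \<in> ?C" for R S u v x
  proof -
    have k: "br R v u \<in> ?C" "br S x u \<in> ?C"
      "sharp A R (?d v) \<in> vector_fields A" "sharp A S (?d x) \<in> vector_fields A"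
      "sharp A R (?d v) u = br R v u" "sharp A S (?d x) u = br S x u"
      using key that by blast+
    have "sharp A R (?d v) (br S x u) = br R v (br S x u)"
      "sharp A S (?d x) (br R v u) = br S x (br R v u)"
      using key that k(1,2) by blast+
    then show ?thesis
      using k(5,6) lie_bracket_vector_field[OF k(3,4)] unfolding differential_def lie_bracket_def
      by simp
  qed
  have out: "sharp A R (?d u) (S (?d v) (?d x)) = - br R (br S v x) u"
    if "R = P \<or> R = Q" "S = P \<or> S = Q" "u \<in> ?C" "v \<in> ?C" "x \<in> ?C" for R S u v x
  proof -
    have k: "br S v x \<in> ?C" using key that by blast
    have "sharp A R (?d u) (br S v x) = br R u (br S v x)"
      "br R u (br S v x) = - br R (br S v x) u"
      using key[OF that(1,3) k] by blast+
    then show ?thesis unfolding br_def by simp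
  qed
  have rot: "br R u (br S v x) = - br R (br S v x) u"
    if "R = P \<or> R = Q" "S = P \<or> S = Q" "u \<in> ?C" "v \<in> ?C" "x \<in> ?C" for R S u v x
    using that key[of S v x] key[of R u "br S v x"] by blast
  have flip: "br R (br S x v) u = - br R (br S v x) u"
    if "R = P \<or> R = Q" "S = P \<or> S = Q" "u \<in> ?C" "v \<in> ?C" "x \<in> ?C" for R S u v x
    using that key[of S v x] key[of S x v] br_neg[of R "br S v x" u] by metis
  have T: "sharp A P (?d u) (Q (?d v) (?d x)) + sharp A Q (?d u) (P (?d v) (?d x))
      - ?d u (lie_bracket (sharp A P (?d v)) (sharp A Q (?d x)))
      - ?d u (lie_bracket (sharp A Q (?d v)) (sharp A P (?d x)))
    = - br P (br Q v x) u - br Q (br P v x) u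
      + br P (br Q x u) v + br Q (br P u v) x + br Q (br P x u) v + br P (br Q u v) x"
    if u: "u \<in> ?C" and v: "v \<in> ?C" and x: "x \<in> ?C" for u v x
    using u v x rot[of P Q v x u] rot[of Q P x v u] rot[of Q P v x u] rot[of P Q x v u]
      flip[of Q P x u v] flip[of P Q x u v]
    by (simp add: lie out)
  show ?thesis
    unfolding schouten_def Let_def T[OF f g h] T[OF g h f] T[OF h f g] by simp
qed

end

theory Submission
  imports Defs
begin

text \<open>
  Write $B = -\sharp_W \circ \flat_\sigma$ and $\theta(X,Y) = \sigma(BX,Y)$. The bivector $W$ and the
  tensor $B$ determine each other because $\flat_\sigma$ is invertible, and $W$ is skew if and only
  if $\sigma(BX,Y) = \sigma(X,BY)$; the equation $\Phi^2 = \epsilon\,Id$ then forces the entry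
  $\kappa$.

  For the integrability, let $N$ be the Courant torsion of $\Phi$. From $\Phi^2 = \epsilon\,Id$ one gets
  $N(\Phi s,t) = -\Phi N(s,t)$. As $\sigma$ is nondegenerate, every section of the big tangent bundle is
  a sum $u + \Phi v$ with vector fields $u$, $v$, so $\Phi$ is integrable if and only if
  $N$ vanishes on pairs of vector fields. There, since $d\sigma = 0$, it has the components
  $N_B(X,Y)$ (the Nijenhuis torsion) and $-i(Y)i(X)d\theta$. On the other side,
  $[w,W](\flat X,\flat Y,\flat Z) = d\theta(X,Y,Z)$ and, if $d\theta = 0$,
  $[W,W](\flat X,\flat Y,\flat Z) = 2\,\sigma(N_B(X,Y),Z)$.
\<close>

section \<open>Vector fields, one-forms and the Courant bracket\<close>

text \<open>The reduction to pairs of vector fields cannot rest on linearity over functions, which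
  the Courant bracket does not have. It rests on additivity and on real linearity, and the latter
  suffices because \<epsilon> is a constant: \<open>\<Phi> (\<Phi> s)\<close> is a constant multiple
  of \<open>s\<close>, so it can be pulled out of the bracket. On pairs of vector fields \<kappa>
  and the transpose of \<open>B\<close> cancel from the torsion, which is why the conditions found
  there concern \<open>B\<close> alone.

  Both remaining entries are solutions of linear equations in which the inverse of the flat map is
  \<open>- sharp A w\<close>. From B = - sharp_W o flat one gets sharp_W = B o sharp_w, the witness
  for surjectivity. Composing B o B + sharp_\<kappa> o flat = \<epsilon> Id on the right with -
  sharp_w gives sharp_\<kappa> = - \<epsilon> sharp_w + B o B o sharp_w, and B o B o sharp_w = B o
  sharp_W = - sharp_W o flat o sharp_W.\<close>

lemma vector_field_apply_zero: "X \<in> vector_fields A \<Longrightarrow> X 0 = 0"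
  using vector_fieldsD(6)[of X A 0 0] zero_smooth[of A] by simp

lemma vector_fields_add:
  "X \<in> vector_fields A \<Longrightarrow> Y \<in> vector_fields A \<Longrightarrow> X + Y \<in> vector_fields A"
  unfolding vector_fields_def by (auto simp: smooth_functions_add algebra_simps)

lemma vector_fields_smul:
  "f \<in> smooth_functions A \<Longrightarrow> X \<in> vector_fields A \<Longrightarrow> smul f X \<in> vector_fields A"
  unfolding vector_fields_def smul_def by (auto simp: smooth_functions_mult algebra_simps)

lemma smul_minus_one: "smul (const_fun (- 1)) X = - X"
  by (simp add: fun_eq_iff smul_def const_fun_def)

lemma vector_fields_uminus: "X \<in> vector_fields A \<Longrightarrow> - X \<in> vector_fields A"
  using vector_fields_smul[OF smooth_functions_const] unfolding smul_minus_one[symmetric] by blast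

lemma vector_fields_diff:
  "X \<in> vector_fields A \<Longrightarrow> Y \<in> vector_fields A \<Longrightarrow> X - Y \<in> vector_fields A"
  using vector_fields_add[OF _ vector_fields_uminus] by fastforce

lemma vector_fields_zero: "0 \<in> vector_fields A"
  by (simp add: vector_fields_def zero_smooth)

lemmas vector_fields_intros = vector_fields_add vector_fields_smul vector_fields_uminus
  vector_fields_diff vector_fields_zero lie_bracket_vector_field

section \<open>Dual modules and alternating forms\<close>

lemma dual_moduleD:
  assumes "\<alpha> \<in> dual_module A S" "X \<in> S"
  shows "\<alpha> X \<in> smooth_functions A"
    and "Y \<in> S \<Longrightarrow> \<alpha> (X + Y) = \<alpha> X + \<alpha> Y"
    and "f \<in> smooth_functions A \<Longrightarrow> \<alpha> (smul f X) = f * \<alpha> X"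
    and "\<alpha> (- X) = - \<alpha> X"
proof -
  show smul: "\<alpha> (smul f X) = f * \<alpha> X" if "f \<in> smooth_functions A" for f
    using assms that by (simp add: dual_module_def)
  show "\<alpha> (- X) = - \<alpha> X"
    using smul[OF smooth_functions_const, of "- 1"] by (simp add: smul_minus_one uminus_fun_eq)
qed (use assms in \<open>auto simp: dual_module_def\<close>)

lemma dual_module_off: "\<alpha> \<in> dual_module A S \<Longrightarrow> X \<notin> S \<Longrightarrow> \<alpha> X = 0"
  by (simp add: dual_module_def)

text \<open>\<open>S\<close> is an arbitrary set here and need not contain 0. If it does, additivity
  gives the value; if not, it is the default value outside \<open>S\<close>.\<close>

lemma dual_module_apply_zero: "\<alpha> \<in> dual_module A S \<Longrightarrow> \<alpha> 0 = 0"
  using dual_moduleD(2)[of \<alpha> A S 0 0] dual_module_off[of \<alpha> A S 0] by (cases "0 \<in> S") auto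

lemma dual_module_eqI:
  "\<alpha> \<in> dual_module A S \<Longrightarrow> \<beta> \<in> dual_module A S \<Longrightarrow> (\<And>X. X \<in> S \<Longrightarrow> \<alpha> X = \<beta> X) \<Longrightarrow> \<alpha> = \<beta>"
  unfolding fun_eq_iff[of \<alpha> \<beta>] by (metis dual_module_off)

lemma dual_module_add:
  "\<alpha> \<in> dual_module A S \<Longrightarrow> \<beta> \<in> dual_module A S \<Longrightarrow> \<alpha> + \<beta> \<in> dual_module A S"
  by (auto simp: dual_module_def smooth_functions_add algebra_simps)

lemma dual_module_smul:
  "f \<in> smooth_functions A \<Longrightarrow> \<alpha> \<in> dual_module A S \<Longrightarrow> smul f \<alpha> \<in> dual_module A S"
  by (auto simp: dual_module_def smul_def smooth_functions_mult algebra_simps)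

lemma dual_module_uminus: "\<alpha> \<in> dual_module A S \<Longrightarrow> - \<alpha> \<in> dual_module A S"
  using dual_module_smul[OF smooth_functions_const] unfolding smul_minus_one[symmetric] by blast

lemma dual_module_diff:
  "\<alpha> \<in> dual_module A S \<Longrightarrow> \<beta> \<in> dual_module A S \<Longrightarrow> \<alpha> - \<beta> \<in> dual_module A S"
  using dual_module_add[OF _ dual_module_uminus] by fastforce

lemma dual_module_zero: "0 \<in> dual_module A S"
  by (simp add: dual_module_def zero_smooth)

lemma alternating_formsD:
  assumes "\<sigma> \<in> alternating_forms A S" "X \<in> S"
  shows "\<sigma> X \<in> dual_module A S"
    and "Y \<in> S \<Longrightarrow> \<sigma> X Y = - \<sigma> Y X"
  using assms unfolding alternating_forms_def by blast+

lemma alternating_forms_off: "\<sigma> \<in> alternating_forms A S \<Longrightarrow> X \<notin> S \<Longrightarrow> \<sigma> X = 0"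
  by (simp add: alternating_forms_def)

lemma alternating_forms_add:
  assumes "\<sigma> \<in> alternating_forms A S" "X \<in> S" "Y \<in> S" "X + Y \<in> S"
  shows "\<sigma> (X + Y) = \<sigma> X + \<sigma> Y"
proof (rule dual_module_eqI[of _ A S])
  fix Z assume Z: "Z \<in> S"
  have "\<sigma> (X + Y) Z = - \<sigma> Z (X + Y)" "\<sigma> X Z = - \<sigma> Z X" "\<sigma> Y Z = - \<sigma> Z Y"
    using alternating_formsD(2)[OF assms(1)] assms Z by blast+
  then show "\<sigma> (X + Y) Z = (\<sigma> X + \<sigma> Y) Z"
    using dual_moduleD(2)[OF alternating_formsD(1)[OF assms(1) Z] assms(2,3)] by simp
qed (use assms in \<open>simp_all add: alternating_formsD(1) dual_module_add\<close>)

lemma alternating_forms_smul: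
  assumes "\<sigma> \<in> alternating_forms A S" "X \<in> S" "f \<in> smooth_functions A" "smul f X \<in> S"
  shows "\<sigma> (smul f X) = smul f (\<sigma> X)"
proof (rule dual_module_eqI[of _ A S])
  fix Z assume Z: "Z \<in> S"
  have "\<sigma> (smul f X) Z = - \<sigma> Z (smul f X)" "\<sigma> X Z = - \<sigma> Z X"
    using alternating_formsD(2)[OF assms(1)] assms Z by blast+
  then show "\<sigma> (smul f X) Z = smul f (\<sigma> X) Z"
    using dual_moduleD(3)[OF alternating_formsD(1)[OF assms(1) Z] assms(2,3)] by (simp add: smul_def)
qed (use assms in \<open>simp_all add: alternating_formsD(1) dual_module_smul\<close>)

lemmas one_formD = dual_moduleD[of _ A "vector_fields A" for A, folded one_forms_def]
lemmas one_form_apply_zero = dual_module_apply_zero[of _ A "vector_fields A" for A, folded one_forms_def]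
lemmas one_form_eqI = dual_module_eqI[of _ A "vector_fields A" for A, folded one_forms_def]
lemmas one_forms_intros =
  dual_module_add[of _ A "vector_fields A" for A, folded one_forms_def]
  dual_module_smul[of _ A _ "vector_fields A" for A, folded one_forms_def]
  dual_module_uminus[of _ A "vector_fields A" for A, folded one_forms_def]
  dual_module_diff[of _ A "vector_fields A" for A, folded one_forms_def]
  dual_module_zero[of A "vector_fields A" for A, folded one_forms_def]

lemma one_form_diff:
  assumes "\<alpha> \<in> one_forms A" "X \<in> vector_fields A" "Y \<in> vector_fields A"
  shows "\<alpha> (X - Y) = \<alpha> X - \<alpha> Y"
  using one_formD(2)[OF assms(1,2) vector_fields_uminus[OF assms(3)]] one_formD(4)[OF assms(1,3)]
  by simp

text \<open>Exact forms already separate vector fields, since df evaluated on X is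
  \<open>X f\<close>.\<close>

lemma vector_field_eqI:
  assumes X: "X \<in> vector_fields A" and Y: "Y \<in> vector_fields A"
    and eq: "\<And>\<beta>. \<beta> \<in> one_forms A \<Longrightarrow> \<beta> X = \<beta> Y"
  shows "X = Y"
proof
  fix f
  show "X f = Y f"
  proof (cases "f \<in> smooth_functions A")
    case True
    then show ?thesis using eq[OF differential_one_form[OF True]] X Y by (simp add: differential_def)
  qed (use vector_fields_off X Y in metis)
qed

lemma vector_field_eq_smoothI:
  "X \<in> vector_fields A \<Longrightarrow> Y \<in> vector_fields A \<Longrightarrow>
   (\<And>f. f \<in> smooth_functions A \<Longrightarrow> X f = Y f) \<Longrightarrow> X = Y"
  unfolding fun_eq_iff[of X Y] by (metis vector_fields_off)

lemma tensors11D: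
  assumes "B \<in> tensors11 A" "X \<in> vector_fields A"
  shows "B X \<in> vector_fields A"
    and "Y \<in> vector_fields A \<Longrightarrow> B (X + Y) = B X + B Y"
    and "f \<in> smooth_functions A \<Longrightarrow> B (smul f X) = smul f (B X)"
    and "B (- X) = - B X"
    and "Y \<in> vector_fields A \<Longrightarrow> B (X - Y) = B X - B Y"
proof -
  have neg: "B (- X) = - B X" if "X \<in> vector_fields A" for X
    using assms(1) that smooth_functions_const[of "- 1" A] unfolding smul_minus_one[symmetric]
    by (simp add: tensors11_def)
  show "B (- X) = - B X" using neg assms(2) .
  show "B (X - Y) = B X - B Y" if "Y \<in> vector_fields A"
  proof -
    have "B (X + (- Y)) = B X + B (- Y)"
      using assms vector_fields_uminus[OF that]
      by (simp add: tensors11_def del: add_uminus_conv_diff)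
    then show ?thesis using neg[OF that] by simp
  qed
qed (use assms in \<open>auto simp: tensors11_def\<close>)

lemma transpose11_one_form:
  "B \<in> tensors11 A \<Longrightarrow> \<alpha> \<in> one_forms A \<Longrightarrow> transpose11 B \<alpha> \<in> one_forms A"
  using one_form_apply_zero[of \<alpha> A]
  by (auto simp: one_forms_def dual_module_def transpose11_def tensors11_def)

section \<open>Lie brackets, Lie derivatives and differentials\<close>

lemma lie_bracket_antisym: "lie_bracket X Y = - lie_bracket Y X"
  by (simp add: lie_bracket_def fun_eq_iff)

lemma lie_bracket_add_left:
  assumes X: "X \<in> vector_fields A" and Y: "Y \<in> vector_fields A" and Z: "Z \<in> vector_fields A"
  shows "lie_bracket (X + Y) Z = lie_bracket X Z + lie_bracket Y Z"
proof (rule vector_field_eq_smoothI[of _ A])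
  fix f assume "f \<in> smooth_functions A"
  then show "lie_bracket (X + Y) Z f = (lie_bracket X Z + lie_bracket Y Z) f"
    by (simp add: lie_bracket_def vector_fieldsD[OF X] vector_fieldsD[OF Y] vector_fieldsD[OF Z])
qed (use assms in \<open>simp_all add: vector_fields_intros\<close>)

lemma lie_bracket_smul_right:
  assumes X: "X \<in> vector_fields A" and Y: "Y \<in> vector_fields A" and f: "f \<in> smooth_functions A"
  shows "lie_bracket X (smul f Y) = smul f (lie_bracket X Y) + smul (X f) Y"
proof (rule vector_field_eq_smoothI[of _ A])
  fix g assume "g \<in> smooth_functions A"
  then show "lie_bracket X (smul f Y) g = (smul f (lie_bracket X Y) + smul (X f) Y) g"
    using f by (simp add: lie_bracket_def smul_def vector_fieldsD[OF X] vector_fieldsD[OF Y]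
        algebra_simps)
qed (use assms vector_fieldsD(1)[OF X f] in \<open>simp_all add: vector_fields_intros\<close>)

lemma lie_bracket_add_right:
  assumes "X \<in> vector_fields A" "Y \<in> vector_fields A" "Z \<in> vector_fields A"
  shows "lie_bracket Z (X + Y) = lie_bracket Z X + lie_bracket Z Y"
  using lie_bracket_add_left[OF assms] lie_bracket_antisym[of Z X] lie_bracket_antisym[of Z Y]
    lie_bracket_antisym[of Z "X + Y"] by simp

lemma lie_bracket_const_left:
  assumes X: "X \<in> vector_fields A" and Z: "Z \<in> vector_fields A"
  shows "lie_bracket (smul (const_fun c) X) Z = smul (const_fun c) (lie_bracket X Z)"
proof (rule vector_field_eq_smoothI[of _ A])
  fix f assume "f \<in> smooth_functions A"
  then show "lie_bracket (smul (const_fun c) X) Z f = smul (const_fun c) (lie_bracket X Z) f"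
    by (simp add: lie_bracket_def smul_def vector_fieldsD[OF X] vector_fieldsD[OF Z] right_diff_distrib)
qed (use assms in \<open>simp_all add: vector_fields_intros smooth_functions_const\<close>)

text \<open>The point is linearity over functions: the term \<open>X f * \<beta> Y\<close> arises
  from the Leibniz rule for X and again from the bracket with \<open>smul f Y\<close>, and the two
  cancel.\<close>

lemma lie_derivative_one_form:
  assumes X: "X \<in> vector_fields A" and \<beta>: "\<beta> \<in> one_forms A"
  shows "lie_derivative A X \<beta> \<in> one_forms A"
  unfolding one_forms_def dual_module_def mem_Collect_eq
proof (intro conjI ballI allI impI)
  note [simp] = vector_fieldsD[OF X] one_formD[OF \<beta>]
  fix Y assume Y: "Y \<in> vector_fields A"
  note XY = lie_bracket_vector_field[OF X Y]
  show "lie_derivative A X \<beta> Y \<in> smooth_functions A"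
    using Y XY by (simp add: lie_derivative_def smooth_functions_diff)
  show "lie_derivative A X \<beta> (Y + Z) = lie_derivative A X \<beta> Y + lie_derivative A X \<beta> Z"
    if Z: "Z \<in> vector_fields A" for Z
    using X Y Z XY lie_bracket_vector_field[OF X Z] vector_fields_add[OF Y Z]
    by (simp add: lie_derivative_def lie_bracket_add_right)
  show "lie_derivative A X \<beta> (smul f Y) = f * lie_derivative A X \<beta> Y"
    if f: "f \<in> smooth_functions A" for f
  proof -
    have "\<beta> (lie_bracket X (smul f Y)) = f * \<beta> (lie_bracket X Y) + X f * \<beta> Y"
      using X Y XY f by (simp add: lie_bracket_smul_right vector_fields_smul)
    moreover have "X (\<beta> (smul f Y)) = f * X (\<beta> Y) + \<beta> Y * X f"
      using Y f by simp
    ultimately show ?thesis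
      using Y f by (simp add: lie_derivative_def vector_fields_smul algebra_simps)
  qed
qed (simp add: lie_derivative_def)

lemma differential_add:
  "f \<in> smooth_functions A \<Longrightarrow> g \<in> smooth_functions A \<Longrightarrow>
   differential A (f + g) = differential A f + differential A g"
  unfolding differential_def by (intro ext) (simp add: vector_fieldsD(2))

lemma differential_const:
  "f \<in> smooth_functions A \<Longrightarrow>
   differential A (const_fun c * f) = smul (const_fun c) (differential A f)"
  unfolding differential_def smul_def by (intro ext) (simp add: vector_fieldsD(4))

lemma lie_derivative_add:
  assumes X: "X \<in> vector_fields A" and X': "X' \<in> vector_fields A"
    and \<beta>: "\<beta> \<in> one_forms A" and \<beta>': "\<beta>' \<in> one_forms A"
  shows "lie_derivative A (X + X') \<beta> = lie_derivative A X \<beta> + lie_derivative A X' \<beta>"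
    and "lie_derivative A X (\<beta> + \<beta>') = lie_derivative A X \<beta> + lie_derivative A X \<beta>'"
proof -
  note [simp] = vector_fieldsD[OF X] one_formD[OF \<beta>] one_formD[OF \<beta>']
  show "lie_derivative A (X + X') \<beta> = lie_derivative A X \<beta> + lie_derivative A X' \<beta>"
    using X X' by (intro ext) (simp add: lie_derivative_def lie_bracket_add_left lie_bracket_vector_field)
  show "lie_derivative A X (\<beta> + \<beta>') = lie_derivative A X \<beta> + lie_derivative A X \<beta>'"
    by (intro ext) (simp add: lie_derivative_def)
qed

lemma lie_derivative_const:
  assumes X: "X \<in> vector_fields A" and \<beta>: "\<beta> \<in> one_forms A"
  shows "lie_derivative A (smul (const_fun c) X) \<beta> = smul (const_fun c) (lie_derivative A X \<beta>)"
    and "lie_derivative A X (smul (const_fun c) \<beta>) = smul (const_fun c) (lie_derivative A X \<beta>)"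
proof -
  note [simp] = vector_fieldsD(4,6)[OF X] one_formD[OF \<beta>] smooth_functions_const[of c A]
  have "\<beta> (lie_bracket (smul (const_fun c) X) Y) = const_fun c * \<beta> (lie_bracket X Y)"
    if "Y \<in> vector_fields A" for Y
    using X that by (simp add: lie_bracket_const_left lie_bracket_vector_field)
  then show "lie_derivative A (smul (const_fun c) X) \<beta> = smul (const_fun c) (lie_derivative A X \<beta>)"
    by (intro ext) (simp add: lie_derivative_def smul_def right_diff_distrib)
  show "lie_derivative A X (smul (const_fun c) \<beta>) = smul (const_fun c) (lie_derivative A X \<beta>)"
    by (intro ext) (simp add: lie_derivative_def smul_def right_diff_distrib)
qed

section \<open>The Courant bracket on sections\<close>

lemma courant_bracket_section:
  assumes "s \<in> big_sections A" "t \<in> big_sections A"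
  shows "courant_bracket A s t \<in> big_sections A"
proof -
  obtain X \<alpha> Y \<beta> where st: "s = (X, \<alpha>)" "t = (Y, \<beta>)" by fastforce
  have V: "X \<in> vector_fields A" "Y \<in> vector_fields A" "\<alpha> \<in> one_forms A" "\<beta> \<in> one_forms A"
    using assms by (auto simp: st big_sections_def)
  have "differential A (\<alpha> Y - \<beta> X) \<in> one_forms A"
    by (intro differential_one_form smooth_functions_diff one_formD(1)[OF V(3,2)] one_formD(1)[OF V(4,1)])
  then show ?thesis
    using V by (simp add: st big_sections_def courant_bracket_def lie_bracket_vector_field
        one_forms_intros lie_derivative_one_form smooth_functions_const)
qed

lemma courant_bracket_antisym:
  assumes "s \<in> big_sections A" "t \<in> big_sections A"
  shows "courant_bracket A s t = - courant_bracket A t s"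
proof -
  obtain X \<alpha> Y \<beta> where st: "s = (X, \<alpha>)" "t = (Y, \<beta>)" by fastforce
  have V: "X \<in> vector_fields A" "Y \<in> vector_fields A" "\<alpha> \<in> one_forms A" "\<beta> \<in> one_forms A"
    using assms by (auto simp: st big_sections_def)
  have f: "\<alpha> Y - \<beta> X \<in> smooth_functions A"
    by (rule smooth_functions_diff[OF one_formD(1)[OF V(3,2)] one_formD(1)[OF V(4,1)]])
  have "\<beta> X - \<alpha> Y = const_fun (- 1) * (\<alpha> Y - \<beta> X)" by (simp flip: uminus_fun_eq)
  then have "differential A (\<beta> X - \<alpha> Y) = - differential A (\<alpha> Y - \<beta> X)"
    using differential_const[OF f] by (simp only: smul_minus_one)
  then show ?thesis
    using lie_bracket_antisym[of X Y] by (simp add: st courant_bracket_def fun_eq_iff smul_def)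
qed

lemma courant_bracket_add_left:
  assumes "s \<in> big_sections A" "s' \<in> big_sections A" "t \<in> big_sections A"
  shows "courant_bracket A (s + s') t = courant_bracket A s t + courant_bracket A s' t"
proof -
  obtain X \<alpha> X' \<alpha>' Y \<beta> where st: "s = (X, \<alpha>)" "s' = (X', \<alpha>')" "t = (Y, \<beta>)" by (metis surj_pair)
  have V: "X \<in> vector_fields A" "Y \<in> vector_fields A" "\<alpha> \<in> one_forms A" "\<beta> \<in> one_forms A"
     "X' \<in> vector_fields A" "\<alpha>' \<in> one_forms A"
    using assms by (auto simp: st big_sections_def)
  have f: "\<alpha> Y - \<beta> X \<in> smooth_functions A" "\<alpha>' Y - \<beta> X' \<in> smooth_functions A"
    by (rule smooth_functions_diff[OF one_formD(1)[OF V(3,2)] one_formD(1)[OF V(4,1)]],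
        rule smooth_functions_diff[OF one_formD(1)[OF V(6,2)] one_formD(1)[OF V(4,5)]])
  have "(\<alpha> + \<alpha>') Y - \<beta> (X + X') = (\<alpha> Y - \<beta> X) + (\<alpha>' Y - \<beta> X')"
    using one_formD(2)[OF V(4,1,5)] by simp
  then have "differential A ((\<alpha> + \<alpha>') Y - \<beta> (X + X')) =
      differential A (\<alpha> Y - \<beta> X) + differential A (\<alpha>' Y - \<beta> X')"
    using differential_add[OF f] by (simp only:)
  then show ?thesis
    using lie_bracket_add_left[OF V(1,5,2)] lie_derivative_add(1)[OF V(1,5,4,4)]
      lie_derivative_add(2)[OF V(2,2,3,6)]
    by (simp add: st courant_bracket_def) (simp add: fun_eq_iff smul_def algebra_simps)
qed

abbreviation big_smul :: "('m \<Rightarrow> real) \<Rightarrow> 'm big \<Rightarrow> 'm big"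
  where "big_smul f \<equiv> map_prod (smul f) (smul f)"

text \<open>Restricted to constants on purpose: pulling a nonconstant function out of the bracket
  produces extra terms with its derivatives.\<close>

lemma courant_bracket_const_left:
  assumes "s \<in> big_sections A" "t \<in> big_sections A"
  shows "courant_bracket A (big_smul (const_fun c) s) t = big_smul (const_fun c) (courant_bracket A s t)"
proof -
  let ?c = "const_fun c"
  obtain X \<alpha> Y \<beta> where st: "s = (X, \<alpha>)" "t = (Y, \<beta>)" by fastforce
  have V: "X \<in> vector_fields A" "Y \<in> vector_fields A" "\<alpha> \<in> one_forms A" "\<beta> \<in> one_forms A"
    using assms by (auto simp: st big_sections_def)
  have f: "\<alpha> Y - \<beta> X \<in> smooth_functions A"
    by (rule smooth_functions_diff[OF one_formD(1)[OF V(3,2)] one_formD(1)[OF V(4,1)]])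
  have "smul ?c \<alpha> Y - \<beta> (smul ?c X) = ?c * (\<alpha> Y - \<beta> X)"
    using one_formD(3)[OF V(4,1) smooth_functions_const[of c A]]
    by (simp add: smul_def[of _ \<alpha>] right_diff_distrib)
  then have "differential A (smul ?c \<alpha> Y - \<beta> (smul ?c X)) = smul ?c (differential A (\<alpha> Y - \<beta> X))"
    using differential_const[OF f] by (simp only:)
  then show ?thesis
    using lie_bracket_const_left[OF V(1,2), of c] lie_derivative_const(1)[OF V(1,4), of c]
      lie_derivative_const(2)[OF V(2,3), of c]
    by (simp add: st courant_bracket_def) (simp add: fun_eq_iff smul_def algebra_simps)
qed

section \<open>The torsion of an endomorphism of the big tangent bundle\<close>

lemma big_sections_intros:
  "s \<in> big_sections A \<Longrightarrow> t \<in> big_sections A \<Longrightarrow> s + t \<in> big_sections A"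
  "s \<in> big_sections A \<Longrightarrow> t \<in> big_sections A \<Longrightarrow> s - t \<in> big_sections A"
  "s \<in> big_sections A \<Longrightarrow> - s \<in> big_sections A"
  "f \<in> smooth_functions A \<Longrightarrow> s \<in> big_sections A \<Longrightarrow> big_smul f s \<in> big_sections A"
  by (auto simp: big_sections_def vector_fields_intros one_forms_intros)

lemma big_smul_minus_one: "big_smul (const_fun (- 1)) s = - s"
  by (cases s) (simp add: smul_minus_one)

lemma big_endomorphismsD:
  assumes "\<Phi> \<in> big_endomorphisms A" "s \<in> big_sections A"
  shows "\<Phi> s \<in> big_sections A"
    and "t \<in> big_sections A \<Longrightarrow> \<Phi> (s + t) = \<Phi> s + \<Phi> t"
    and "f \<in> smooth_functions A \<Longrightarrow> \<Phi> (big_smul f s) = big_smul f (\<Phi> s)"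
    and "\<Phi> (- s) = - \<Phi> s"
    and "t \<in> big_sections A \<Longrightarrow> \<Phi> (s - t) = \<Phi> s - \<Phi> t"
proof -
  show add: "\<Phi> (s + t) = \<Phi> s + \<Phi> t" if "t \<in> big_sections A" for t
    using assms that unfolding big_endomorphisms_def by blast
  show smul: "\<Phi> (big_smul f s) = big_smul f (\<Phi> s)" if "f \<in> smooth_functions A" for f
    using assms that unfolding big_endomorphisms_def by blast
  have neg: "\<Phi> (- s) = - \<Phi> s" if "s \<in> big_sections A" for s
    using assms(1) that smooth_functions_const[of "- 1" A]
    unfolding big_endomorphisms_def big_smul_minus_one[symmetric] by blast
  show "\<Phi> (- s) = - \<Phi> s" using neg[OF assms(2)] .
  show "\<Phi> (s - t) = \<Phi> s - \<Phi> t" if "t \<in> big_sections A"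
    using add[OF big_sections_intros(3)[OF that]] neg[OF that] by simp
qed (use assms in \<open>simp add: big_endomorphisms_def\<close>)

definition courant_torsion ::
    "('m, 'e::real_normed_vector) atlas \<Rightarrow> ('m big \<Rightarrow> 'm big) \<Rightarrow> 'm big \<Rightarrow> 'm big \<Rightarrow> 'm big"
  where "courant_torsion A \<Phi> s t =
    courant_bracket A (\<Phi> s) (\<Phi> t) - \<Phi> (courant_bracket A s (\<Phi> t))
    - \<Phi> (courant_bracket A (\<Phi> s) t) + \<Phi> (\<Phi> (courant_bracket A s t))"

lemma courant_torsion_antisym:
  assumes \<Phi>: "\<Phi> \<in> big_endomorphisms A" and s: "s \<in> big_sections A" and t: "t \<in> big_sections A"
  shows "courant_torsion A \<Phi> s t = - courant_torsion A \<Phi> t s"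
proof -
  note E = big_endomorphismsD[OF \<Phi>] and C = courant_bracket_section
  note \<Phi>s = E(1)[OF s] and \<Phi>t = E(1)[OF t]
  have *: "\<Phi> (courant_bracket A u v) = - \<Phi> (courant_bracket A v u)"
    if "u \<in> big_sections A" "v \<in> big_sections A" for u v
    unfolding courant_bracket_antisym[OF that] by (rule E(4)[OF C[OF that(2,1)]])
  have "\<Phi> (\<Phi> (courant_bracket A s t)) = - \<Phi> (\<Phi> (courant_bracket A t s))"
    unfolding *[OF s t] by (rule E(4)[OF E(1)[OF C[OF t s]]])
  then show ?thesis
    using courant_bracket_antisym[OF \<Phi>s \<Phi>t] *[OF s \<Phi>t] *[OF \<Phi>s t] by (simp add: courant_torsion_def)
qed

lemma courant_torsion_add_left:
  assumes \<Phi>: "\<Phi> \<in> big_endomorphisms A" and s: "s \<in> big_sections A" and s': "s' \<in> big_sections A"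
    and t: "t \<in> big_sections A"
  shows "courant_torsion A \<Phi> (s + s') t = courant_torsion A \<Phi> s t + courant_torsion A \<Phi> s' t"
proof -
  note E = big_endomorphismsD[OF \<Phi>] and C = courant_bracket_section
  note \<Phi>s = E(1)[OF s] and \<Phi>s' = E(1)[OF s'] and \<Phi>t = E(1)[OF t]
  show ?thesis
    unfolding courant_torsion_def E(2)[OF s s'] courant_bracket_add_left[OF s s' t]
      courant_bracket_add_left[OF s s' \<Phi>t] courant_bracket_add_left[OF \<Phi>s \<Phi>s' t]
      courant_bracket_add_left[OF \<Phi>s \<Phi>s' \<Phi>t] E(2)[OF C[OF s t] C[OF s' t]]
      E(2)[OF C[OF s \<Phi>t] C[OF s' \<Phi>t]] E(2)[OF C[OF \<Phi>s t] C[OF \<Phi>s' t]]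
      E(2)[OF E(1)[OF C[OF s t]] E(1)[OF C[OF s' t]]]
    by simp
qed

text \<open>Replacing \<open>s\<close> by \<open>\<Phi> s\<close> turns the first and third brackets
  into brackets with \<open>\<Phi> (\<Phi> s)\<close>, from which the constant \<epsilon> comes out
  as an outer \<Phi> o \<Phi>. The four terms are then those of - \<Phi> N(s,t), in another
  order.\<close>

lemma courant_torsion_apply_left:
  assumes \<Phi>: "\<Phi> \<in> big_endomorphisms A"
    and sq: "\<And>s. s \<in> big_sections A \<Longrightarrow> \<Phi> (\<Phi> s) = big_smul (const_fun \<epsilon>) s"
    and s: "s \<in> big_sections A" and t: "t \<in> big_sections A"
  shows "courant_torsion A \<Phi> (\<Phi> s) t = - \<Phi> (courant_torsion A \<Phi> s t)"
proof -
  note E = big_endomorphismsD[OF \<Phi>] and C = courant_bracket_section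
  note \<Phi>s = E(1)[OF s] and \<Phi>t = E(1)[OF t]
  let ?a = "courant_bracket A (\<Phi> s) (\<Phi> t)" and ?b = "\<Phi> (courant_bracket A s (\<Phi> t))"
    and ?c = "\<Phi> (courant_bracket A (\<Phi> s) t)" and ?d = "\<Phi> (\<Phi> (courant_bracket A s t))"
  have mem: "?a \<in> big_sections A" "?b \<in> big_sections A" "?c \<in> big_sections A" "?d \<in> big_sections A"
    using E(1) C s t by blast+
  \<comment> \<open>The square is first read as multiplication by \<epsilon>, moved out of the
    bracket as a constant, and then read as a square again.\<close>
  have sq_left: "courant_bracket A (\<Phi> (\<Phi> s)) u = \<Phi> (\<Phi> (courant_bracket A s u))"
    if "u \<in> big_sections A" for u
    by (simp add: sq s C that courant_bracket_const_left)
  have "\<Phi> (?a - ?b - ?c + ?d) = \<Phi> ?a - \<Phi> ?b - \<Phi> ?c + \<Phi> ?d"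
    using mem by (simp add: E(2,5) big_sections_intros)
  then show ?thesis
    by (simp add: courant_torsion_def sq_left t \<Phi>t)
qed

text \<open>The torsion is extended in one argument at a time. Writing s as u + \<Phi> v frees the
  left argument, antisymmetry exchanges the arguments, and the same extension frees the other one.
  \<open>S\<close> need not be a submodule.\<close>

lemma courant_torsion_eq_zero:
  assumes \<Phi>: "\<Phi> \<in> big_endomorphisms A"
    and sq: "\<And>s. s \<in> big_sections A \<Longrightarrow> \<Phi> (\<Phi> s) = big_smul (const_fun \<epsilon>) s"
    and S: "S \<subseteq> big_sections A"
    and gen: "\<And>s. s \<in> big_sections A \<Longrightarrow> \<exists>u\<in>S. \<exists>v\<in>S. s = u + \<Phi> v"
    and zero: "\<And>u v. u \<in> S \<Longrightarrow> v \<in> S \<Longrightarrow> courant_torsion A \<Phi> u v = 0"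
    and s: "s \<in> big_sections A" and t: "t \<in> big_sections A"
  shows "courant_torsion A \<Phi> s t = 0"
proof -
  have \<Phi>0: "\<Phi> 0 = 0" using big_endomorphismsD(5)[OF \<Phi> s s] by simp
  have extend: "courant_torsion A \<Phi> s t = 0"
    if s: "s \<in> big_sections A" and t: "t \<in> big_sections A"
      and z: "\<And>u. u \<in> S \<Longrightarrow> courant_torsion A \<Phi> u t = 0" for s t
  proof -
    obtain u v where uv: "u \<in> S" "v \<in> S" "s = u + \<Phi> v" using gen[OF s] by blast
    then have m: "u \<in> big_sections A" "v \<in> big_sections A" using S by auto
    show ?thesis
      using courant_torsion_add_left[OF \<Phi> m(1) big_endomorphismsD(1)[OF \<Phi> m(2)] t]
        courant_torsion_apply_left[OF \<Phi> sq m(2) t] z uv \<Phi>0 by simp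
  qed
  have "courant_torsion A \<Phi> s u = 0" if u: "u \<in> S" for u
    using extend[OF s _ zero[OF _ u]] S u by blast
  then have "courant_torsion A \<Phi> u s = 0" if "u \<in> S" for u
    using courant_torsion_antisym[OF \<Phi>, of u s] S that s by auto
  then have "courant_torsion A \<Phi> t s = 0" using extend[OF t s] by blast
  then show ?thesis using courant_torsion_antisym[OF \<Phi> s t] by simp
qed

text \<open>The invariant formula for the exterior derivative, kept apart from the closedness
  condition because it is also evaluated on the form \<theta> below, which is not known to be
  closed.\<close>

definition d_form2 :: "'m form2 \<Rightarrow> 'm vfield \<Rightarrow> 'm vfield \<Rightarrow> 'm vfield \<Rightarrow> 'm \<Rightarrow> real"
  where "d_form2 \<sigma> X Y Z = X (\<sigma> Y Z) + Y (\<sigma> Z X) + Z (\<sigma> X Y)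
    - \<sigma> (lie_bracket X Y) Z - \<sigma> (lie_bracket Y Z) X - \<sigma> (lie_bracket Z X) Y"

definition nijenhuis :: "'m tensor11 \<Rightarrow> 'm vfield \<Rightarrow> 'm vfield \<Rightarrow> 'm vfield"
  where "nijenhuis B X Y = lie_bracket (B X) (B Y) - B (lie_bracket X (B Y))
    - B (lie_bracket (B X) Y) + B (B (lie_bracket X Y))"

lemma nijenhuis_vector_field:
  assumes B: "B \<in> tensors11 A" and X: "X \<in> vector_fields A" and Y: "Y \<in> vector_fields A"
  shows "nijenhuis B X Y \<in> vector_fields A"
  using X Y by (simp add: nijenhuis_def vector_fields_intros tensors11D(1)[OF B])

text \<open>A curried two-form is already a map from vector fields to one-forms, so \<sigma> itself
  serves as its flat map from here on.\<close>

lemma flat_eq [simp]: "flat \<sigma> = \<sigma>"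
  by (simp add: flat_def fun_eq_iff)

lemma lie_derivative_zero: "X \<in> vector_fields A \<Longrightarrow> lie_derivative A X 0 = 0"
  by (intro ext) (simp add: lie_derivative_def vector_field_apply_zero)

lemma differential_zero: "differential A 0 = 0"
  by (intro ext) (simp add: differential_def vector_field_apply_zero)

section \<open>Bivector fields on a symplectic manifold\<close>

text \<open>Recovers a bivector from a prescribed sharp map \<open>K\<close>;
  \<open>sharp_bivector_of\<close> shows that \<open>K\<close> is indeed its sharp map. The default
  0 is what membership in \<open>bivector_fields\<close> demands outside the one-forms.\<close>

definition bivector_of ::
    "('m, 'e::real_normed_vector) atlas \<Rightarrow> ('m form1 \<Rightarrow> 'm vfield) \<Rightarrow> 'm bivector"
  where "bivector_of A K = (\<lambda>\<alpha> \<beta>. if \<alpha> \<in> one_forms A \<and> \<beta> \<in> one_forms A then \<beta> (K \<alpha>) else 0)"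

lemma bivector_of_bivector_field:
  assumes K: "\<And>\<alpha>. \<alpha> \<in> one_forms A \<Longrightarrow> K \<alpha> \<in> vector_fields A"
    and skew: "\<And>\<alpha> \<beta>. \<alpha> \<in> one_forms A \<Longrightarrow> \<beta> \<in> one_forms A \<Longrightarrow> \<beta> (K \<alpha>) = - \<alpha> (K \<beta>)"
  shows "bivector_of A K \<in> bivector_fields A"
  unfolding bivector_fields_def alternating_forms_def mem_Collect_eq
proof (intro conjI ballI allI impI)
  show "bivector_of A K \<alpha> \<in> dual_module A (one_forms A)" if \<alpha>: "\<alpha> \<in> one_forms A" for \<alpha>
    unfolding dual_module_def mem_Collect_eq
  proof (intro conjI ballI allI impI)
    fix \<beta> assume \<beta>: "\<beta> \<in> one_forms A"
    show "bivector_of A K \<alpha> \<beta> \<in> smooth_functions A"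
      using \<alpha> \<beta> one_formD(1)[OF \<beta> K[OF \<alpha>]] by (simp add: bivector_of_def)
    show "bivector_of A K \<alpha> (\<beta> + \<gamma>) = bivector_of A K \<alpha> \<beta> + bivector_of A K \<alpha> \<gamma>"
      if \<gamma>: "\<gamma> \<in> one_forms A" for \<gamma>
      using \<alpha> \<beta> \<gamma> one_forms_intros(1)[OF \<beta> \<gamma>] by (simp add: bivector_of_def)
    show "bivector_of A K \<alpha> (smul f \<beta>) = f * bivector_of A K \<alpha> \<beta>" if f: "f \<in> smooth_functions A" for f
      using \<alpha> \<beta> one_forms_intros(2)[OF f \<beta>] by (simp add: bivector_of_def smul_def[of f \<beta>])
  qed (simp add: bivector_of_def)
  show "bivector_of A K \<alpha> \<beta> = - bivector_of A K \<beta> \<alpha>"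
    if "\<alpha> \<in> one_forms A" "\<beta> \<in> one_forms A" for \<alpha> \<beta>
    using skew[OF that] by (simp only: bivector_of_def that if_True simp_thms)
  show "bivector_of A K \<alpha> = 0" if "\<alpha> \<notin> one_forms A" for \<alpha>
    using that by (simp add: bivector_of_def fun_eq_iff)
qed

locale symplectic_structure =
  fixes A :: "('m::{t2_space,second_countable_topology}, 'e::real_normed_vector) atlas"
    and \<sigma> :: "'m form2"
  assumes symplectic: "symplectic_form A \<sigma>"
begin

abbreviation C where "C \<equiv> smooth_functions A"
abbreviation V where "V \<equiv> vector_fields A"
abbreviation \<Omega> where "\<Omega> \<equiv> one_forms A"

lemma form2: "\<sigma> \<in> alternating_forms A V"
  using symplectic by (simp add: symplectic_form_def two_forms_def)

lemma closed: "X \<in> V \<Longrightarrow> Y \<in> V \<Longrightarrow> Z \<in> V \<Longrightarrow> d_form2 \<sigma> X Y Z = 0"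
  using symplectic by (simp add: symplectic_form_def closed_form2_def d_form2_def)

lemma sigma_one_form: "X \<in> V \<Longrightarrow> \<sigma> X \<in> \<Omega>"
  using alternating_formsD(1)[OF form2] by (simp add: one_forms_def)

lemma sigma_skew: "X \<in> V \<Longrightarrow> Y \<in> V \<Longrightarrow> \<sigma> X Y = - \<sigma> Y X"
  by (rule alternating_formsD(2)[OF form2])

lemma sigma_smooth: "X \<in> V \<Longrightarrow> Y \<in> V \<Longrightarrow> \<sigma> X Y \<in> C"
  by (rule one_formD(1)[OF sigma_one_form])

lemma sigma_off: "X \<notin> V \<Longrightarrow> \<sigma> X = 0"
  by (rule alternating_forms_off[OF form2])

lemma sigma_add: "X \<in> V \<Longrightarrow> Y \<in> V \<Longrightarrow> \<sigma> (X + Y) = \<sigma> X + \<sigma> Y"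
  by (rule alternating_forms_add[OF form2]) (auto intro: vector_fields_add)

lemma sigma_smul: "f \<in> C \<Longrightarrow> X \<in> V \<Longrightarrow> \<sigma> (smul f X) = smul f (\<sigma> X)"
  by (rule alternating_forms_smul[OF form2]) (auto intro: vector_fields_smul)

lemma sigma_uminus: "X \<in> V \<Longrightarrow> \<sigma> (- X) = - \<sigma> X"
  using sigma_smul[OF smooth_functions_const, of X "- 1"] by (simp add: smul_minus_one)

lemma sigma_diff: "X \<in> V \<Longrightarrow> Y \<in> V \<Longrightarrow> \<sigma> (X - Y) = \<sigma> X - \<sigma> Y"
  using sigma_add[OF _ vector_fields_uminus, of X Y] sigma_uminus[of Y] by simp

lemma sigma_inj: "X \<in> V \<Longrightarrow> Y \<in> V \<Longrightarrow> \<sigma> X = \<sigma> Y \<Longrightarrow> X = Y"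
  using symplectic by (auto simp: symplectic_form_def bij_betw_def inj_on_def)

lemma sigma_surj:
  assumes "\<alpha> \<in> \<Omega>"
  obtains X where "X \<in> V" "\<alpha> = \<sigma> X"
  using symplectic assms by (auto simp: symplectic_form_def bij_betw_def)

text \<open>Nondegeneracy makes the module of vector fields reflexive, without local coordinates.\<close>
lemma sharp_ex1:
  assumes \<xi>: "\<xi> \<in> dual_module A \<Omega>"
  shows "\<exists>!X. X \<in> V \<and> (\<forall>\<beta>\<in>\<Omega>. \<beta> X = \<xi> \<beta>)"
proof -
  have "(\<lambda>X. \<xi> (\<sigma> X)) \<in> \<Omega>"
    unfolding one_forms_def[of A] dual_module_def[of A V]
    by (auto simp: sigma_add sigma_smul sigma_off dual_module_apply_zero[OF \<xi>] dual_moduleD[OF \<xi>]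
        sigma_one_form)
  then obtain Z where Z: "Z \<in> V" "(\<lambda>X. \<xi> (\<sigma> X)) = \<sigma> Z" by (rule sigma_surj)
  \<comment> \<open>The representing field is minus the one that \<sigma> assigns to the pulled-back
    functional: for \<beta> = \<sigma> Y the arguments have to be exchanged, \<sigma> Y Z = -
    \<sigma> Z Y.\<close>
  have eval: "\<beta> (- Z) = \<xi> \<beta>" if \<beta>: "\<beta> \<in> \<Omega>" for \<beta>
  proof -
    obtain Y where Y: "Y \<in> V" "\<beta> = \<sigma> Y" using sigma_surj[OF \<beta>] .
    have "\<beta> (- Z) = \<sigma> Z Y" using one_formD(4)[OF \<beta> Z(1)] sigma_skew[OF Y(1) Z(1)] Y(2) by simp
    also have "\<dots> = \<xi> \<beta>" using fun_cong[OF Z(2), of Y] Y(2) by simp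
    finally show ?thesis .
  qed
  show ?thesis
  proof (rule ex1I[of _ "- Z"])
    show "- Z \<in> V \<and> (\<forall>\<beta>\<in>\<Omega>. \<beta> (- Z) = \<xi> \<beta>)" using eval Z(1) vector_fields_uminus by blast
    show "X = - Z" if "X \<in> V \<and> (\<forall>\<beta>\<in>\<Omega>. \<beta> X = \<xi> \<beta>)" for X
      using that eval vector_fields_uminus[OF Z(1)] by (intro vector_field_eqI[of _ A]) auto
  qed
qed

text \<open>Discharges the definite description in \<open>sharp\<close>, by \<open>sharp_ex1\<close>
  for the functional \<open>\<pi> \<alpha>\<close>.\<close>

lemma sharp:
  assumes "\<pi> \<in> bivector_fields A" "\<alpha> \<in> \<Omega>"
  shows "sharp A \<pi> \<alpha> \<in> V" and "\<beta> \<in> \<Omega> \<Longrightarrow> \<beta> (sharp A \<pi> \<alpha>) = \<pi> \<alpha> \<beta>"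
proof -
  have "\<pi> \<alpha> \<in> dual_module A \<Omega>"
    using assms alternating_formsD(1) unfolding bivector_fields_def by blast
  from theI'[OF sharp_ex1[OF this]]
  show "sharp A \<pi> \<alpha> \<in> V" "\<beta> \<in> \<Omega> \<Longrightarrow> \<beta> (sharp A \<pi> \<alpha>) = \<pi> \<alpha> \<beta>"
    using assms(2) by (simp_all add: sharp_def)
qed

lemma sharp_eqI:
  assumes "\<pi> \<in> bivector_fields A" "\<alpha> \<in> \<Omega>" "X \<in> V" "\<And>\<beta>. \<beta> \<in> \<Omega> \<Longrightarrow> \<beta> X = \<pi> \<alpha> \<beta>"
  shows "sharp A \<pi> \<alpha> = X"
  using assms sharp[OF assms(1,2)] by (intro vector_field_eqI[of _ A]) auto

lemma sharp_skew:
  assumes \<pi>: "\<pi> \<in> bivector_fields A" and \<alpha>: "\<alpha> \<in> \<Omega>" and \<beta>: "\<beta> \<in> \<Omega>"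
  shows "\<beta> (sharp A \<pi> \<alpha>) = - \<alpha> (sharp A \<pi> \<beta>)"
proof -
  have "\<pi> \<alpha> \<beta> = - \<pi> \<beta> \<alpha>" using \<pi> \<alpha> \<beta> alternating_formsD(2) unfolding bivector_fields_def by blast
  then show ?thesis unfolding sharp(2)[OF \<pi> \<alpha> \<beta>] sharp(2)[OF \<pi> \<beta> \<alpha>] .
qed

lemma sharp_add:
  assumes \<pi>: "\<pi> \<in> bivector_fields A" and \<alpha>: "\<alpha> \<in> \<Omega>" and \<beta>: "\<beta> \<in> \<Omega>"
  shows "sharp A \<pi> (\<alpha> + \<beta>) = sharp A \<pi> \<alpha> + sharp A \<pi> \<beta>"
proof (rule vector_field_eqI[of _ A])
  have ab: "\<alpha> + \<beta> \<in> \<Omega>" using \<alpha> \<beta> by (rule one_forms_intros)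
  note m = sharp(1)[OF \<pi> \<alpha>] sharp(1)[OF \<pi> \<beta>]
  show "sharp A \<pi> (\<alpha> + \<beta>) \<in> V" "sharp A \<pi> \<alpha> + sharp A \<pi> \<beta> \<in> V"
    using sharp(1)[OF \<pi> ab] m by (auto intro: vector_fields_add)
  fix \<gamma> assume \<gamma>: "\<gamma> \<in> \<Omega>"
  show "\<gamma> (sharp A \<pi> (\<alpha> + \<beta>)) = \<gamma> (sharp A \<pi> \<alpha> + sharp A \<pi> \<beta>)"
    using sharp_skew[OF \<pi> ab \<gamma>] sharp_skew[OF \<pi> \<alpha> \<gamma>] sharp_skew[OF \<pi> \<beta> \<gamma>] one_formD(2)[OF \<gamma> m]
    by simp
qed

lemma sharp_smul:
  assumes \<pi>: "\<pi> \<in> bivector_fields A" and \<alpha>: "\<alpha> \<in> \<Omega>" and f: "f \<in> C"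
  shows "sharp A \<pi> (smul f \<alpha>) = smul f (sharp A \<pi> \<alpha>)"
proof (rule vector_field_eqI[of _ A])
  have fa: "smul f \<alpha> \<in> \<Omega>" using f \<alpha> by (rule one_forms_intros)
  note m = sharp(1)[OF \<pi> \<alpha>]
  show "sharp A \<pi> (smul f \<alpha>) \<in> V" "smul f (sharp A \<pi> \<alpha>) \<in> V"
    using sharp(1)[OF \<pi> fa] m f by (auto intro: vector_fields_smul)
  fix \<gamma> assume \<gamma>: "\<gamma> \<in> \<Omega>"
  show "\<gamma> (sharp A \<pi> (smul f \<alpha>)) = \<gamma> (smul f (sharp A \<pi> \<alpha>))"
    using sharp_skew[OF \<pi> fa \<gamma>] sharp_skew[OF \<pi> \<alpha> \<gamma>] one_formD(3)[OF \<gamma> m f]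
    by (simp add: smul_def[of f \<alpha>])
qed

lemma sharp_zero: "\<pi> \<in> bivector_fields A \<Longrightarrow> sharp A \<pi> 0 = 0"
  using sharp_add[OF _ one_forms_intros(5) one_forms_intros(5)] by simp

lemma sharp_bivector_of:
  assumes K: "\<And>\<alpha>. \<alpha> \<in> \<Omega> \<Longrightarrow> K \<alpha> \<in> V"
    and skew: "\<And>\<alpha> \<beta>. \<alpha> \<in> \<Omega> \<Longrightarrow> \<beta> \<in> \<Omega> \<Longrightarrow> \<beta> (K \<alpha>) = - \<alpha> (K \<beta>)"
    and \<alpha>: "\<alpha> \<in> \<Omega>"
  shows "sharp A (bivector_of A K) \<alpha> = K \<alpha>"
proof (rule sharp_eqI[OF _ \<alpha> K[OF \<alpha>]])
  show "bivector_of A K \<in> bivector_fields A"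
    using K skew by (rule bivector_of_bivector_field)
  show "\<beta> (K \<alpha>) = bivector_of A K \<alpha> \<beta>" if "\<beta> \<in> \<Omega>" for \<beta>
    using \<alpha> that by (simp add: bivector_of_def)
qed

lemma bivector_eqI:
  assumes P: "P \<in> bivector_fields A" and Q: "Q \<in> bivector_fields A"
    and eq: "\<And>\<alpha>. \<alpha> \<in> \<Omega> \<Longrightarrow> sharp A P \<alpha> = sharp A Q \<alpha>"
  shows "P = Q"
proof
  fix \<alpha>
  show "P \<alpha> = Q \<alpha>"
  proof (cases "\<alpha> \<in> \<Omega>")
    case True
    then have "P \<alpha> \<in> dual_module A \<Omega>" "Q \<alpha> \<in> dual_module A \<Omega>"
      using P Q alternating_formsD(1) unfolding bivector_fields_def by blast+
    then show ?thesis
      using sharp(2)[OF P True] sharp(2)[OF Q True] eq[OF True] by (auto intro: dual_module_eqI)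
  next
    case False
    then show ?thesis using P Q alternating_forms_off unfolding bivector_fields_def by metis
  qed
qed

end

lemma smul_add_right: "smul f (X + Y) = smul f X + smul f Y"
  by (simp add: smul_def fun_eq_iff algebra_simps)

lemma smul_diff_right: "smul f (X - Y) = smul f X - smul f Y"
  by (simp add: smul_def fun_eq_iff algebra_simps)

text \<open>For the Schouten bracket on forms \<sigma> X, where both sharp maps carry a minus sign:
  - X for w and - B X for W.\<close>

lemma lie_bracket_uminus_uminus:
  assumes X: "X \<in> vector_fields A" and Y: "Y \<in> vector_fields A"
  shows "lie_bracket (- X) (- Y) = lie_bracket X Y"
proof (rule vector_field_eq_smoothI[of _ A])
  fix f assume f: "f \<in> smooth_functions A"
  have "X (- Y f) = - X (Y f)" "Y (- X f) = - Y (X f)"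
    using vector_fieldsD(5)[OF X vector_fieldsD(1)[OF Y f]]
      vector_fieldsD(5)[OF Y vector_fieldsD(1)[OF X f]] by auto
  then show "lie_bracket (- X) (- Y) f = lie_bracket X Y f" by (simp add: lie_bracket_def)
qed (use assms in \<open>simp_all add: vector_fields_intros\<close>)

section \<open>Consequences of closedness, and the almost structure condition for a matrix with
  entry \<sigma>\<close>

context symplectic_structure
begin

lemma derivative_sigma_skew:
  assumes "X \<in> V" "Y \<in> V" "Z \<in> V"
  shows "X (\<sigma> Y Z) = - X (\<sigma> Z Y)"
  unfolding sigma_skew[OF assms(2,3)] by (rule vector_fieldsD(5)[OF assms(1) sigma_smooth[OF assms(3,2)]])

lemma sigma_bracket_flip:
  assumes "X \<in> V" "Y \<in> V" "Z \<in> V"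
  shows "\<sigma> (lie_bracket X Y) Z = \<sigma> Z (lie_bracket Y X)"
proof -
  have "lie_bracket X Y = - lie_bracket Y X" by (rule lie_bracket_antisym)
  then show ?thesis
    using sigma_uminus[of "lie_bracket Y X"] sigma_skew[of "lie_bracket Y X" Z]
      lie_bracket_vector_field[OF assms(2,1)] assms by simp
qed

text \<open>This is $L_U \sigma = d(i(U)\sigma)$.\<close>
lemma cartan_formula:
  assumes U: "U \<in> V" and Y: "Y \<in> V" and Z: "Z \<in> V"
  shows "U (\<sigma> Y Z) - \<sigma> Y (lie_bracket U Z) - \<sigma> (lie_bracket U Y) Z =
    Y (\<sigma> U Z) - Z (\<sigma> U Y) - \<sigma> U (lie_bracket Y Z)"
proof
  fix p
  show "(U (\<sigma> Y Z) - \<sigma> Y (lie_bracket U Z) - \<sigma> (lie_bracket U Y) Z) p =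
    (Y (\<sigma> U Z) - Z (\<sigma> U Y) - \<sigma> U (lie_bracket Y Z)) p"
    using fun_cong[OF closed[OF U Y Z], of p] fun_cong[OF derivative_sigma_skew[OF Y Z U], of p]
      fun_cong[OF sigma_skew[OF lie_bracket_vector_field[OF Y Z] U], of p]
      fun_cong[OF sigma_bracket_flip[OF Z U Y], of p]
    by (simp add: d_form2_def)
qed

lemma courant_bracket_vectors:
  assumes "X \<in> V" "Y \<in> V"
  shows "courant_bracket A (X, 0) (Y, 0) = (lie_bracket X Y, 0)"
  using assms by (simp add: courant_bracket_def lie_derivative_zero differential_zero)
    (simp add: fun_eq_iff smul_def)

text \<open>The two brackets are taken together because each contributes one half of d(\<sigma> X
  Y). Only with the whole differential does \<open>cartan_formula\<close> for U = X turn the form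
  part into the contraction of \<sigma> with [X,Y]. The fields X' and Y' meet only the zero form, so
  they leave no trace there.\<close>

lemma courant_bracket_mixed:
  assumes X: "X \<in> V" and Y: "Y \<in> V" and X': "X' \<in> V" and Y': "Y' \<in> V"
  shows "courant_bracket A (X, 0) (Y', \<sigma> Y) + courant_bracket A (X', \<sigma> X) (Y, 0) =
    (lie_bracket X Y' + lie_bracket X' Y, \<sigma> (lie_bracket X Y))"
proof -
  let ?h = "smul (const_fun (1/2)) (differential A (\<sigma> X Y))"
  have diff: "0 - \<sigma> Y X = \<sigma> X Y" "\<sigma> X Y - 0 = \<sigma> X Y"
    using sigma_skew[OF X Y] by auto
  \<comment> \<open>The zeros are the Lie derivatives of the zero form; the sum keeps the shape in
    which unfolding the two brackets leaves it.\<close>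
  have "lie_derivative A X (\<sigma> Y) - 0 + ?h + (0 - lie_derivative A Y (\<sigma> X) + ?h) = \<sigma> (lie_bracket X Y)"
  proof (rule one_form_eqI[of _ A])
    show "\<sigma> (lie_bracket X Y) \<in> \<Omega>" by (rule sigma_one_form[OF lie_bracket_vector_field[OF X Y]])
    show "lie_derivative A X (\<sigma> Y) - 0 + ?h + (0 - lie_derivative A Y (\<sigma> X) + ?h) \<in> \<Omega>"
      by (intro one_forms_intros lie_derivative_one_form sigma_one_form smooth_functions_const
          differential_one_form sigma_smooth X Y)
    fix Z assume Z: "Z \<in> V"
    show "(lie_derivative A X (\<sigma> Y) - 0 + ?h + (0 - lie_derivative A Y (\<sigma> X) + ?h)) Z =
        \<sigma> (lie_bracket X Y) Z"
    proof
      fix p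
      show "(lie_derivative A X (\<sigma> Y) - 0 + ?h + (0 - lie_derivative A Y (\<sigma> X) + ?h)) Z p =
          \<sigma> (lie_bracket X Y) Z p"
        using fun_cong[OF cartan_formula[OF X Y Z], of p] Z
        by (simp add: lie_derivative_def smul_def const_fun_def differential_def)
    qed
  qed
  then show ?thesis
    using X' Y' by (simp add: courant_bracket_def lie_derivative_zero diff del: diff_0 diff_0_right)
qed

lemma courant_bracket_graph:
  assumes "X' \<in> V" "Y' \<in> V" "Z \<in> V"
  shows "snd (courant_bracket A (X', \<sigma> X) (Y', \<sigma> Y)) Z =
    X' (\<sigma> Y Z) - \<sigma> Y (lie_bracket X' Z) - (Y' (\<sigma> X Z) - \<sigma> X (lie_bracket Y' Z))
    + const_fun (1/2) * Z (\<sigma> X Y' - \<sigma> Y X')"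
  using assms by (simp add: courant_bracket_def lie_derivative_def differential_def smul_def)

abbreviation Phi :: "'m tensor11 \<Rightarrow> 'm bivector \<Rightarrow> 'm big \<Rightarrow> 'm big"
  where "Phi B \<kappa> \<equiv> big_matrix A B (sharp A \<kappa>) \<sigma> (\<lambda>\<alpha>. - transpose11 B \<alpha>)"

lemma Phi_apply:
  "X \<in> V \<Longrightarrow> \<alpha> \<in> \<Omega> \<Longrightarrow> Phi B \<kappa> (X, \<alpha>) = (B X + sharp A \<kappa> \<alpha>, \<sigma> X - transpose11 B \<alpha>)"
  by (simp add: big_matrix_def big_sections_def)

lemma Phi_endomorphism:
  assumes B: "B \<in> tensors11 A" and \<kappa>: "\<kappa> \<in> bivector_fields A"
  shows "Phi B \<kappa> \<in> big_endomorphisms A"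
proof -
  have t: "transpose11 B (\<alpha> + \<beta>) = transpose11 B \<alpha> + transpose11 B \<beta>"
    "transpose11 B (smul f \<alpha>) = smul f (transpose11 B \<alpha>)" for \<alpha> \<beta> f
    by (auto simp: transpose11_def smul_def fun_eq_iff)
  note [simp] = one_forms_intros vector_fields_intros sigma_one_form transpose11_one_form[OF B]
    tensors11D[OF B] sharp(1)[OF \<kappa>] Phi_apply t sigma_add sigma_smul sharp_add[OF \<kappa>] sharp_smul[OF \<kappa>]
  have 1: "Phi B \<kappa> (X, \<alpha>) \<in> big_sections A" if "X \<in> V" "\<alpha> \<in> \<Omega>" for X \<alpha>
    using that by (simp add: big_sections_def)
  have 2: "Phi B \<kappa> (X + Y, \<alpha> + \<beta>) = Phi B \<kappa> (X, \<alpha>) + Phi B \<kappa> (Y, \<beta>)"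
    if "X \<in> V" "\<alpha> \<in> \<Omega>" "Y \<in> V" "\<beta> \<in> \<Omega>" for X \<alpha> Y \<beta>
    using that by simp
  have 3: "Phi B \<kappa> (smul f X, smul f \<alpha>) = big_smul f (Phi B \<kappa> (X, \<alpha>))"
    if "X \<in> V" "\<alpha> \<in> \<Omega>" "f \<in> C" for X \<alpha> f
    using that by (simp add: smul_add_right smul_diff_right)
  have 4: "Phi B \<kappa> s = 0" if "s \<notin> big_sections A" for s
    using that by (cases s) (simp add: big_matrix_def)
  show ?thesis
    unfolding big_endomorphisms_def mem_Collect_eq
    using 1 2 3 4 by (auto simp add: big_sections_def simp del: Phi_apply)
qed

text \<open>The shape of the matrix alone gives this: the parts with \<open>B\<close> and with its
  negative transpose cancel, and \<kappa> and \<sigma> are skew.\<close>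

lemma Phi_metric_skew:
  assumes B: "B \<in> tensors11 A" and \<kappa>: "\<kappa> \<in> bivector_fields A"
    and X: "X \<in> V" and \<alpha>: "\<alpha> \<in> \<Omega>" and Y: "Y \<in> V" and \<beta>: "\<beta> \<in> \<Omega>"
  shows "big_metric (X, \<alpha>) (Phi B \<kappa> (Y, \<beta>)) + big_metric (Phi B \<kappa> (X, \<alpha>)) (Y, \<beta>) = 0"
proof
  fix p
  show "(big_metric (X, \<alpha>) (Phi B \<kappa> (Y, \<beta>)) + big_metric (Phi B \<kappa> (X, \<alpha>)) (Y, \<beta>)) p = 0 p"
    using fun_cong[OF sharp_skew[OF \<kappa> \<alpha> \<beta>], of p] fun_cong[OF sigma_skew[OF X Y], of p]
      one_formD(2)[OF \<alpha> tensors11D(1)[OF B Y] sharp(1)[OF \<kappa> \<beta>]]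
      one_formD(2)[OF \<beta> tensors11D(1)[OF B X] sharp(1)[OF \<kappa> \<alpha>]]
    unfolding Phi_apply[OF X \<alpha>] Phi_apply[OF Y \<beta>]
    by (simp add: big_metric_def transpose11_def const_fun_def field_simps)
qed

lemma transpose11_sigma:
  assumes B: "B \<in> tensors11 A" and X: "X \<in> V"
    and sym: "\<And>X Y. X \<in> V \<Longrightarrow> Y \<in> V \<Longrightarrow> \<sigma> (B X) Y = \<sigma> X (B Y)"
  shows "transpose11 B (\<sigma> X) = \<sigma> (B X)"
proof (rule one_form_eqI[of _ A])
  show "transpose11 B (\<sigma> X) \<in> \<Omega>" "\<sigma> (B X) \<in> \<Omega>"
    using X by (simp_all add: transpose11_one_form[OF B] sigma_one_form tensors11D(1)[OF B])
  show "transpose11 B (\<sigma> X) Y = \<sigma> (B X) Y" if "Y \<in> V" for Y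
    using sym[OF X that] by (simp add: transpose11_def)
qed

text \<open>The two conditions are the form part and the vector part of \<Phi> o \<Phi> = \<epsilon>
  Id on sections (X, 0). They also suffice, because every one-form is some \<sigma> Z, so that the
  second column of the square is determined by them.\<close>

lemma Phi_generalized_almost_cps_iff:
  assumes B: "B \<in> tensors11 A" and \<kappa>: "\<kappa> \<in> bivector_fields A"
  shows "generalized_almost_cps A \<epsilon> (Phi B \<kappa>) \<longleftrightarrow>
    (\<forall>X\<in>V. \<forall>Y\<in>V. \<sigma> (B X) Y = \<sigma> X (B Y)) \<and>
    (\<forall>X\<in>V. B (B X) + sharp A \<kappa> (\<sigma> X) = smul (const_fun \<epsilon>) X)" (is "?L \<longleftrightarrow> ?R")
proof
  assume L: ?L
  have "\<sigma> (B X) = transpose11 B (\<sigma> X) \<and> B (B X) + sharp A \<kappa> (\<sigma> X) = smul (const_fun \<epsilon>) X"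
    if X: "X \<in> V" for X
  proof -
    have "Phi B \<kappa> (Phi B \<kappa> (X, 0)) = big_smul (const_fun \<epsilon>) (X, 0)"
      using L X one_forms_intros(5)[of A] unfolding generalized_almost_cps_def big_sections_def by blast
    moreover have "Phi B \<kappa> (X, 0) = (B X, \<sigma> X)"
      using X by (simp add: Phi_apply one_forms_intros(5) sharp_zero[OF \<kappa>])
        (simp add: fun_eq_iff transpose11_def)
    ultimately show ?thesis
      using X by (simp add: Phi_apply sigma_one_form tensors11D(1)[OF B]) (simp add: fun_eq_iff smul_def)
  qed
  then show ?R by (simp add: transpose11_def)
next
  assume R: ?R
  note t = transpose11_sigma[OF B]
  have sq: "Phi B \<kappa> (Phi B \<kappa> (X, \<alpha>)) = big_smul (const_fun \<epsilon>) (X, \<alpha>)"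
    if X: "X \<in> V" and \<alpha>: "\<alpha> \<in> \<Omega>" for X \<alpha>
  proof -
    obtain Z where Z: "Z \<in> V" "\<alpha> = \<sigma> Z" using sigma_surj[OF \<alpha>] .
    let ?\<epsilon> = "const_fun \<epsilon> :: 'm \<Rightarrow> real"
    note [simp] = tensors11D[OF B] X Z(1) sigma_one_form sharp(1)[OF \<kappa>] vector_fields_intros
      smooth_functions_const
    have k: "sharp A \<kappa> (\<sigma> U) = smul ?\<epsilon> U - B (B U)" if "U \<in> V" for U
      using R that by (auto simp: algebra_simps)
    have tr: "transpose11 B (\<sigma> U) = \<sigma> (B U)" if "U \<in> V" for U
      using R that by (intro t) auto
    \<comment> \<open>In the coordinates (U, U') for the section (U, \<sigma> U'), \<Phi> involves
      only \<open>B\<close> and \<epsilon>. Applying it twice, the powers of \<open>B\<close> cancel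
      and (\<epsilon> U, \<epsilon> U') remains.\<close>
    have 1: "Phi B \<kappa> (U, \<sigma> U') = (B U + (smul ?\<epsilon> U' - B (B U')), \<sigma> (U - B U'))"
      if "U \<in> V" "U' \<in> V" for U U'
      using that by (simp add: Phi_apply k tr sigma_diff)
    show ?thesis
      by (simp add: Z(2) 1 smul_diff_right sigma_smul[symmetric])
  qed
  show ?L
    unfolding generalized_almost_cps_def big_sections_def
    using Phi_endomorphism[OF B \<kappa>] Phi_metric_skew[OF B \<kappa>] sq by blast
qed

end

section \<open>Integrability\<close>

locale symplectic_tensor = symplectic_structure A \<sigma>
  for A :: "('m::{t2_space,second_countable_topology}, 'e::real_normed_vector) atlas" and \<sigma> +
  fixes B :: "'m tensor11"
  assumes B: "B \<in> tensors11 A"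
    and sym: "X \<in> V \<Longrightarrow> Y \<in> V \<Longrightarrow> \<sigma> (B X) Y = \<sigma> X (B Y)"
begin

abbreviation \<theta> :: "'m form2" where "\<theta> \<equiv> \<lambda>X. \<sigma> (B X)"

lemma BV: "X \<in> V \<Longrightarrow> B X \<in> V"
  by (rule tensors11D(1)[OF B])

lemma theta_skew: "X \<in> V \<Longrightarrow> Y \<in> V \<Longrightarrow> \<theta> X Y = - \<theta> Y X"
  using sym[of X Y] sigma_skew[of X "B Y"] BV[of Y] by simp

lemma derivative_theta_skew:
  assumes "X \<in> V" "Y \<in> V" "Z \<in> V"
  shows "X (\<theta> Y Z) = - X (\<theta> Z Y)"
  unfolding theta_skew[OF assms(2,3)]
  by (rule vector_fieldsD(5)[OF assms(1) sigma_smooth[OF BV[OF assms(3)] assms(2)]])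

text \<open>Since \<Phi> (X, 0) = (B X, \<sigma> X), the torsion is built from brackets on the graph
  of \<sigma>. The two mixed brackets occur only through their sum, which
  \<open>courant_bracket_mixed\<close> evaluates.\<close>

lemma courant_torsion_vectors:
  assumes \<kappa>: "\<kappa> \<in> bivector_fields A"
    and sq: "\<And>X. X \<in> V \<Longrightarrow> B (B X) + sharp A \<kappa> (\<sigma> X) = smul (const_fun \<epsilon>) X"
    and X: "X \<in> V" and Y: "Y \<in> V"
  shows "fst (courant_torsion A (Phi B \<kappa>) (X, 0) (Y, 0)) = nijenhuis B X Y"
    and "Z \<in> V \<Longrightarrow> snd (courant_torsion A (Phi B \<kappa>) (X, 0) (Y, 0)) Z = - d_form2 \<theta> X Y Z"
proof -
  let ?\<Phi> = "Phi B \<kappa>" and ?m = "lie_bracket X (B Y) + lie_bracket (B X) Y" and ?b = "lie_bracket X Y"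
  note [simp] = X Y BV sigma_one_form sharp(1)[OF \<kappa>] vector_fields_intros
    one_forms_intros(5) sharp_zero[OF \<kappa>]
  have t0: "transpose11 B 0 = 0" by (simp add: transpose11_def fun_eq_iff)
  have \<Phi>v: "?\<Phi> (U, 0) = (B U, \<sigma> U)" if "U \<in> V" for U
    using that by (simp add: Phi_apply t0)
  have mem: "(U, 0) \<in> big_sections A" "(B U, \<sigma> U) \<in> big_sections A" if "U \<in> V" for U
    using that by (simp_all add: big_sections_def)
  have "?\<Phi> (courant_bracket A (X, 0) (B Y, \<sigma> Y)) + ?\<Phi> (courant_bracket A (B X, \<sigma> X) (Y, 0))
      = ?\<Phi> (?m, \<sigma> ?b)"
    unfolding courant_bracket_mixed[OF X Y BV[OF X] BV[OF Y], symmetric]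
    by (rule big_endomorphismsD(2)[symmetric, OF Phi_endomorphism[OF B \<kappa>]
          courant_bracket_section[OF mem(1)[OF X] mem(2)[OF Y]]
          courant_bracket_section[OF mem(2)[OF X] mem(1)[OF Y]]])
  moreover have "?\<Phi> (?m, \<sigma> ?b) = (B ?m + sharp A \<kappa> (\<sigma> ?b), \<sigma> ?m - transpose11 B (\<sigma> ?b))"
    by (simp add: Phi_apply)
  moreover have "?\<Phi> (?\<Phi> (?b, 0)) = (B (B ?b) + sharp A \<kappa> (\<sigma> ?b), \<sigma> (B ?b) - transpose11 B (\<sigma> ?b))"
    by (simp add: \<Phi>v Phi_apply t0)
  moreover have "courant_torsion A ?\<Phi> (X, 0) (Y, 0) = courant_bracket A (B X, \<sigma> X) (B Y, \<sigma> Y)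
      - (?\<Phi> (courant_bracket A (X, 0) (B Y, \<sigma> Y)) + ?\<Phi> (courant_bracket A (B X, \<sigma> X) (Y, 0)))
      + ?\<Phi> (?\<Phi> (?b, 0))"
    by (simp add: courant_torsion_def \<Phi>v courant_bracket_vectors)
  \<comment> \<open>The sum of the mixed brackets and the bracket [X,Y] carry the same terms
    \<open>sharp A \<kappa> (\<sigma> ?b)\<close> and \<open>transpose11 B (\<sigma> ?b)\<close>,
    with opposite signs in the torsion. This removes \<kappa> and the transpose.\<close>
  ultimately have T: "courant_torsion A ?\<Phi> (X, 0) (Y, 0) = courant_bracket A (B X, \<sigma> X) (B Y, \<sigma> Y)
      + (B (B ?b) - B ?m, \<sigma> (B ?b) - \<sigma> ?m)"
    by simp
  show "fst (courant_torsion A ?\<Phi> (X, 0) (Y, 0)) = nijenhuis B X Y"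
    unfolding T by (simp add: courant_bracket_def nijenhuis_def tensors11D[OF B])
  show "snd (courant_torsion A ?\<Phi> (X, 0) (Y, 0)) Z = - d_form2 \<theta> X Y Z" if Z: "Z \<in> V"
  proof
    fix p
    \<comment> \<open>The factor 2 compensates the 1/2 in the Courant bracket.\<close>
    have skew: "\<sigma> X (B Y) - \<sigma> Y (B X) = const_fun 2 * \<theta> X Y"
      using sym[OF X Y] sym[OF Y X] theta_skew[OF X Y] by (simp add: fun_eq_iff const_fun_def)
    have d: "Z (\<sigma> X (B Y) - \<sigma> Y (B X)) = const_fun 2 * Z (\<theta> X Y)"
      unfolding skew by (rule vector_fieldsD(4)[OF Z sigma_smooth[OF BV[OF X] Y]])
    have m: "\<sigma> ?m = \<sigma> (lie_bracket X (B Y)) + \<sigma> (lie_bracket (B X) Y)"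
      by (rule sigma_add) simp_all
    \<comment> \<open>\<open>cartan_formula\<close> with U = B X, minus the same with U = B Y,
      eliminates the derivatives along B X and B Y and the brackets of B X with Y and of X with B Y.
      What remains is written in \<theta>; the other facts only put its terms in cyclic
      order.\<close>
    show "snd (courant_torsion A ?\<Phi> (X, 0) (Y, 0)) Z p = (- d_form2 \<theta> X Y Z) p"
      unfolding T m snd_add plus_fun_apply courant_bracket_graph[OF BV[OF X] BV[OF Y] Z] d
      using fun_cong[OF cartan_formula[OF BV[OF X] Y Z], of p]
        fun_cong[OF cartan_formula[OF BV[OF Y] X Z], of p] Z
        fun_cong[OF derivative_theta_skew[OF Y X Z], of p]
        fun_cong[OF derivative_theta_skew[OF Z Y X], of p]
        fun_cong[OF sigma_bracket_flip[OF BV[OF Y] X Z], of p]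
        fun_cong[OF sigma_skew[of "lie_bracket X (B Y)" Z], of p]
        fun_cong[OF theta_skew[of "lie_bracket Y Z" X], of p]
        fun_cong[OF theta_skew[of "lie_bracket Z X" Y], of p]
        fun_cong[OF sigma_bracket_flip[OF Z X BV[OF Y]], of p]
        fun_cong[OF sym[of "lie_bracket Z X" Y], of p]
      by (simp add: d_form2_def const_fun_def)
  qed
qed

lemma integrable_cps_iff:
  assumes \<kappa>: "\<kappa> \<in> bivector_fields A"
    and sq: "\<And>X. X \<in> V \<Longrightarrow> B (B X) + sharp A \<kappa> (\<sigma> X) = smul (const_fun \<epsilon>) X"
  shows "integrable_cps A (Phi B \<kappa>) \<longleftrightarrow>
    (\<forall>X\<in>V. \<forall>Y\<in>V. nijenhuis B X Y = 0) \<and> (\<forall>X\<in>V. \<forall>Y\<in>V. \<forall>Z\<in>V. d_form2 \<theta> X Y Z = 0)"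
proof -
  let ?\<Phi> = "Phi B \<kappa>" and ?S = "(\<lambda>X. (X, 0)) ` V"
  note E = Phi_endomorphism[OF B \<kappa>]
  have almost: "generalized_almost_cps A \<epsilon> ?\<Phi>"
    using Phi_generalized_almost_cps_iff[OF B \<kappa>] sq sym by blast
  have S: "?S \<subseteq> big_sections A"
    by (auto simp: big_sections_def one_forms_intros)
  have gen: "\<exists>u\<in>?S. \<exists>v\<in>?S. s = u + ?\<Phi> v" if mem: "s \<in> big_sections A" for s
  proof -
    obtain X \<alpha> where s: "s = (X, \<alpha>)" "X \<in> V" "\<alpha> \<in> \<Omega>" using mem unfolding big_sections_def by blast
    obtain Z where Z: "Z \<in> V" "\<alpha> = \<sigma> Z" using sigma_surj[OF s(3)] .
    have "transpose11 B 0 = 0" by (simp add: transpose11_def fun_eq_iff)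
    \<comment> \<open>\<Phi> (Z, 0) = (B Z, \<sigma> Z) has the required form part, and X - B Z
      corrects the vector part.\<close>
    then have "s = (X - B Z, 0) + ?\<Phi> (Z, 0)"
      using s(1) Z by (simp add: Phi_apply one_forms_intros(5) sharp_zero[OF \<kappa>])
    moreover have "X - B Z \<in> V" using s(2) Z(1) by (simp add: vector_fields_diff BV)
    ultimately show ?thesis using Z(1) by blast
  qed
  have "integrable_cps A ?\<Phi> \<longleftrightarrow>
      (\<forall>s\<in>big_sections A. \<forall>t\<in>big_sections A. courant_torsion A ?\<Phi> s t = 0)"
    by (simp add: integrable_cps_def courant_torsion_def)
  also have "\<dots> \<longleftrightarrow> (\<forall>s\<in>?S. \<forall>t\<in>?S. courant_torsion A ?\<Phi> s t = 0)"
  proof -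
    have sq': "?\<Phi> (?\<Phi> s) = big_smul (const_fun \<epsilon>) s" if "s \<in> big_sections A" for s
      using almost that by (simp add: generalized_almost_cps_def)
    show ?thesis
      using courant_torsion_eq_zero[OF E sq' S gen] S by blast
  qed
  also have "\<dots> \<longleftrightarrow> (\<forall>X\<in>V. \<forall>Y\<in>V. courant_torsion A ?\<Phi> (X, 0) (Y, 0) = 0)"
    by simp
  also have "\<dots> \<longleftrightarrow>
    (\<forall>X\<in>V. \<forall>Y\<in>V. nijenhuis B X Y = 0 \<and> (\<forall>Z\<in>V. d_form2 \<theta> X Y Z = 0))"
  proof (intro ball_cong refl)
    fix X Y assume X: "X \<in> V" and Y: "Y \<in> V"
    let ?t = "courant_torsion A ?\<Phi> (X, 0) (Y, 0)"
    have "(X, 0) \<in> big_sections A" "(Y, 0) \<in> big_sections A" using X Y S by auto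
    then have "?t \<in> big_sections A"
      unfolding courant_torsion_def
      by (intro big_sections_intros big_endomorphismsD(1)[OF E] courant_bracket_section)
    then have snd: "snd ?t \<in> \<Omega>" by (auto simp: big_sections_def mem_Times_iff)
    have "snd ?t = 0 \<longleftrightarrow> (\<forall>Z\<in>V. snd ?t Z = 0)"
    proof
      assume "\<forall>Z\<in>V. snd ?t Z = 0"
      then show "snd ?t = 0"
        by (intro one_form_eqI[OF snd one_forms_intros(5)]) (simp only: zero_fun_apply)
    qed simp
    also have "\<dots> \<longleftrightarrow> (\<forall>Z\<in>V. d_form2 \<theta> X Y Z = 0)"
    proof (intro ball_cong refl)
      fix Z assume "Z \<in> V"
      then have "snd ?t Z = - d_form2 \<theta> X Y Z"
        using sq by (intro courant_torsion_vectors(2)[OF \<kappa> _ X Y])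
      then show "snd ?t Z = 0 \<longleftrightarrow> d_form2 \<theta> X Y Z = 0"
        by (simp only: neg_equal_0_iff_equal)
    qed
    finally have "snd ?t = 0 \<longleftrightarrow> (\<forall>Z\<in>V. d_form2 \<theta> X Y Z = 0)" .
    moreover have "fst ?t = nijenhuis B X Y"
      by (rule courant_torsion_vectors(1)[OF \<kappa> sq X Y])
    ultimately show "?t = 0 \<longleftrightarrow> nijenhuis B X Y = 0 \<and> (\<forall>Z\<in>V. d_form2 \<theta> X Y Z = 0)"
      by (simp only: prod_eq_iff fst_zero snd_zero)
  qed
  finally show ?thesis by blast
qed

text \<open>Combines $d\sigma(BY, BZ, X) = 0$, $d\sigma(BZ, BX, Y) = 0$ and $d\theta(BZ, X, Y) = 0$.\<close>
lemma sigma_nijenhuis: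
  assumes d: "\<And>X Y Z. X \<in> V \<Longrightarrow> Y \<in> V \<Longrightarrow> Z \<in> V \<Longrightarrow> d_form2 \<theta> X Y Z = 0"
    and X: "X \<in> V" and Y: "Y \<in> V" and Z: "Z \<in> V"
  shows "\<sigma> (nijenhuis B X Y) Z =
    - (B X (\<theta> Y Z) + B Y (\<theta> Z X) + B Z (\<theta> X Y)
       + \<sigma> X (lie_bracket (B Y) (B Z)) + \<sigma> Y (lie_bracket (B Z) (B X)) + \<sigma> Z (lie_bracket (B X) (B Y)))"
proof
  fix p
  note [simp] = X Y Z BV lie_bracket_vector_field
  have N: "\<sigma> (nijenhuis B X Y) Z = - \<sigma> Z (lie_bracket (B X) (B Y)) - \<theta> (lie_bracket X (B Y)) Z
      - \<theta> (lie_bracket (B X) Y) Z + \<theta> (B (lie_bracket X Y)) Z"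
    using sigma_skew[of "lie_bracket (B X) (B Y)" Z]
    by (simp add: nijenhuis_def sigma_add sigma_diff vector_fields_intros)
  have 1: "B Y (\<theta> Z X) + B Z (\<theta> X Y) + X (\<theta> Y (B Z)) + \<sigma> X (lie_bracket (B Y) (B Z))
      - \<theta> (lie_bracket (B Z) X) Y - \<theta> (lie_bracket X (B Y)) Z = 0"
    using closed[of "B Y" "B Z" X] sigma_skew[of "lie_bracket (B Y) (B Z)" X]
      sym[of X Y] sym[of "lie_bracket (B Z) X" Y] sym[of "lie_bracket X (B Y)" Z]
    by (simp add: d_form2_def)
  have 2: "B Z (\<theta> X Y) + B X (\<theta> Y Z) + Y (\<theta> Z (B X)) + \<sigma> Y (lie_bracket (B Z) (B X))
      - \<theta> (lie_bracket (B X) Y) Z - \<theta> (lie_bracket Y (B Z)) X = 0"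
    using closed[of "B Z" "B X" Y] sigma_skew[of "lie_bracket (B Z) (B X)" Y]
      sym[of Y Z] sym[of "lie_bracket (B X) Y" Z] sym[of "lie_bracket Y (B Z)" X]
    by (simp add: d_form2_def)
  have 3: "B Z (\<theta> X Y) + X (\<theta> Y (B Z)) + Y (\<theta> Z (B X))
      - \<theta> (lie_bracket (B Z) X) Y - \<theta> (B (lie_bracket X Y)) Z - \<theta> (lie_bracket Y (B Z)) X = 0"
    using d[of "B Z" X Y] sym[of "B Z" X] sym[of "B (lie_bracket X Y)" Z]
    by (simp add: d_form2_def)
  \<comment> \<open>In the combination 1 + 2 - 3 the derivatives along X and Y and the terms with
    [B Z, X] and [Y, B Z] cancel. Substituting it into N replaces its three \<theta> terms by the
    cyclic expression.\<close>
  show "\<sigma> (nijenhuis B X Y) Z p =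
    (- (B X (\<theta> Y Z) + B Y (\<theta> Z X) + B Z (\<theta> X Y)
       + \<sigma> X (lie_bracket (B Y) (B Z)) + \<sigma> Y (lie_bracket (B Z) (B X)) + \<sigma> Z (lie_bracket (B X) (B Y)))) p"
    using fun_cong[OF N, of p] fun_cong[OF 1, of p] fun_cong[OF 2, of p] fun_cong[OF 3, of p]
    by simp
qed

section \<open>The Schouten bracket\<close>

text \<open>The link between the two sides: the flat map of \<sigma> carries \<open>W\<close> to the
  two-form \<theta>, just as it carries \<open>w\<close> to \<sigma>.\<close>

lemma bivector_eval:
  assumes W: "W \<in> bivector_fields A" "\<And>X. X \<in> V \<Longrightarrow> sharp A W (\<sigma> X) = - B X"
    and X: "X \<in> V" and Y: "Y \<in> V"
  shows "W (\<sigma> X) (\<sigma> Y) = \<theta> X Y"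
proof -
  have "W (\<sigma> X) (\<sigma> Y) = \<sigma> Y (- B X)"
    using sharp(2)[OF W(1) sigma_one_form[OF X] sigma_one_form[OF Y]] W(2)[OF X] by simp
  also have "\<dots> = \<theta> X Y"
    using one_formD(4)[OF sigma_one_form[OF Y] BV[OF X]] sigma_skew[OF BV[OF X] Y] by simp
  finally show ?thesis .
qed

text \<open>The derivatives along \<open>sharp A w\<close> contribute each term X(\<theta> Y Z) once
  with a minus sign; the terms with \<open>B\<close>, rewritten by \<open>cartan_formula\<close>,
  contribute it twice with a plus sign and supply the bracket terms.\<close>

lemma schouten_compatible:
  assumes w: "w \<in> bivector_fields A" "\<And>X. X \<in> V \<Longrightarrow> sharp A w (\<sigma> X) = - X"
    and W: "W \<in> bivector_fields A" "\<And>X. X \<in> V \<Longrightarrow> sharp A W (\<sigma> X) = - B X"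
    and X: "X \<in> V" and Y: "Y \<in> V" and Z: "Z \<in> V"
  shows "schouten A w W (\<sigma> X) (\<sigma> Y) (\<sigma> Z) = d_form2 \<theta> X Y Z"
proof
  fix p
  have w_eval: "w (\<sigma> U) (\<sigma> U') = \<sigma> U U'" if "U \<in> V" "U' \<in> V" for U U'
  proof -
    have "w (\<sigma> U) (\<sigma> U') = \<sigma> U' (- U)"
      using sharp(2)[OF w(1) sigma_one_form[OF that(1)] sigma_one_form[OF that(2)]] w(2)[OF that(1)]
      by simp
    also have "\<dots> = \<sigma> U U'"
      using one_formD(4)[OF sigma_one_form[OF that(2)] that(1)] sigma_skew[OF that] by simp
    finally show ?thesis .
  qed
  \<comment> \<open>Collects the terms of the cyclic sum in which \<open>B\<close> is applied to U;
    there is one such group for each of X, Y, Z. Closedness of \<sigma> enters here.\<close>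
  have cartan: "B U (\<sigma> U' U'') p + \<sigma> U' (lie_bracket U'' (B U)) p + \<sigma> U'' (lie_bracket (B U) U') p =
      - U' (\<theta> U'' U) p - U'' (\<theta> U U') p + \<theta> (lie_bracket U' U'') U p"
    if "U \<in> V" "U' \<in> V" "U'' \<in> V" for U U' U''
    using fun_cong[OF cartan_formula[OF BV[OF that(1)] that(2,3)], of p]
      fun_cong[OF sigma_bracket_flip[OF that(3) BV[OF that(1)] that(2)], of p]
      fun_cong[OF sigma_skew[OF lie_bracket_vector_field[OF that(3) BV[OF that(1)]] that(2)], of p]
      fun_cong[OF sigma_skew[OF lie_bracket_vector_field[OF BV[OF that(1)] that(2)] that(3)], of p]
      fun_cong[OF theta_skew[OF lie_bracket_vector_field[OF that(2,3)] that(1)], of p]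
      fun_cong[OF derivative_theta_skew[OF that(2,3,1)], of p]
    by simp
  show "schouten A w W (\<sigma> X) (\<sigma> Y) (\<sigma> Z) p = d_form2 \<theta> X Y Z p"
    using cartan[OF X Y Z] cartan[OF Y Z X] cartan[OF Z X Y]
    by (simp add: schouten_def Let_def d_form2_def w(2) W(2) w_eval bivector_eval[OF W]
        lie_bracket_uminus_uminus[of _ A] X Y Z BV)
qed

text \<open>With both bivectors equal, the paired terms of the Schouten bracket coincide, hence the
  factor 2; the rest is the cyclic expression of \<open>sigma_nijenhuis\<close>.\<close>

lemma schouten_self:
  assumes d: "\<And>X Y Z. X \<in> V \<Longrightarrow> Y \<in> V \<Longrightarrow> Z \<in> V \<Longrightarrow> d_form2 \<theta> X Y Z = 0"
    and W: "W \<in> bivector_fields A" "\<And>X. X \<in> V \<Longrightarrow> sharp A W (\<sigma> X) = - B X"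
    and X: "X \<in> V" and Y: "Y \<in> V" and Z: "Z \<in> V"
  shows "schouten A W W (\<sigma> X) (\<sigma> Y) (\<sigma> Z) = const_fun 2 * \<sigma> (nijenhuis B X Y) Z"
proof
  fix p
  show "schouten A W W (\<sigma> X) (\<sigma> Y) (\<sigma> Z) p = (const_fun 2 * \<sigma> (nijenhuis B X Y) Z) p"
    using fun_cong[OF sigma_nijenhuis[OF d X Y Z], of p]
    by (simp add: schouten_def Let_def W(2) bivector_eval[OF W] const_fun_def
        lie_bracket_uminus_uminus[of _ A] X Y Z BV)
qed

lemma poisson_compatible_iff:
  assumes w: "w \<in> bivector_fields A" "\<And>X. X \<in> V \<Longrightarrow> sharp A w (\<sigma> X) = - X"
    and W: "W \<in> bivector_fields A" "\<And>X. X \<in> V \<Longrightarrow> sharp A W (\<sigma> X) = - B X"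
  shows "poisson A W \<and> schouten_vanishes A w W \<longleftrightarrow>
    (\<forall>X\<in>V. \<forall>Y\<in>V. nijenhuis B X Y = 0) \<and> (\<forall>X\<in>V. \<forall>Y\<in>V. \<forall>Z\<in>V. d_form2 \<theta> X Y Z = 0)"
proof -
  \<comment> \<open>The flat map of \<sigma> is onto, so one-form arguments may be taken to be
    \<sigma> X.\<close>
  have forms: "(\<forall>\<alpha>\<in>\<Omega>. P \<alpha>) \<longleftrightarrow> (\<forall>X\<in>V. P (\<sigma> X))" for P
    by (metis sigma_surj sigma_one_form)
  have compat: "schouten_vanishes A w W \<longleftrightarrow> (\<forall>X\<in>V. \<forall>Y\<in>V. \<forall>Z\<in>V. d_form2 \<theta> X Y Z = 0)"
    by (simp add: schouten_vanishes_def forms schouten_compatible[OF w W])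
  \<comment> \<open>The Poisson condition is compared with the Nijenhuis torsion only under
    closedness of \<theta>. Both sides of the claim contain that closedness, the left one as
    compatibility with \<open>w\<close>.\<close>
  have "schouten_vanishes A W W \<longleftrightarrow> (\<forall>X\<in>V. \<forall>Y\<in>V. nijenhuis B X Y = 0)"
    if "\<forall>X\<in>V. \<forall>Y\<in>V. \<forall>Z\<in>V. d_form2 \<theta> X Y Z = 0"
  proof -
    have "nijenhuis B X Y = 0 \<longleftrightarrow> (\<forall>Z\<in>V. const_fun 2 * \<sigma> (nijenhuis B X Y) Z = 0)"
      if X: "X \<in> V" and Y: "Y \<in> V" for X Y
    proof
      assume z: "\<forall>Z\<in>V. const_fun 2 * \<sigma> (nijenhuis B X Y) Z = 0"
      have N: "nijenhuis B X Y \<in> V" by (rule nijenhuis_vector_field[OF B X Y])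
      have "\<sigma> (nijenhuis B X Y) = \<sigma> 0"
      proof (rule one_form_eqI[of _ A])
        fix Z assume "Z \<in> V"
        with z have "const_fun 2 * \<sigma> (nijenhuis B X Y) Z = 0" by blast
        then show "\<sigma> (nijenhuis B X Y) Z = \<sigma> 0 Z"
          using sigma_diff[OF N N] by (simp add: fun_eq_iff const_fun_def)
      qed (use N in \<open>auto intro: sigma_one_form vector_fields_zero\<close>)
      then show "nijenhuis B X Y = 0" by (rule sigma_inj[OF N vector_fields_zero])
    next
      assume "nijenhuis B X Y = 0"
      then show "\<forall>Z\<in>V. const_fun 2 * \<sigma> (nijenhuis B X Y) Z = 0"
        using sigma_diff[OF vector_fields_zero vector_fields_zero] by simp
    qed
    then show ?thesis
      using that by (simp add: schouten_vanishes_def forms schouten_self[OF _ W])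
  qed
  then show ?thesis using compat W(1) by (auto simp: poisson_def)
qed

end

section \<open>The correspondence\<close>

locale symplectic_poisson = symplectic_structure A \<sigma>
  for A :: "('m::{t2_space,second_countable_topology}, 'e::real_normed_vector) atlas" and \<sigma> +
  fixes w :: "'m bivector" and \<epsilon> :: real
  assumes poisson_bivector: "poisson_bivector_of A \<sigma> w"
begin

lemma w: "w \<in> bivector_fields A" "X \<in> V \<Longrightarrow> sharp A w (\<sigma> X) = - X"
  using poisson_bivector by (simp_all add: poisson_bivector_of_def)

text \<open>The definition of \<open>w\<close> gives the composition in the other order;
  surjectivity of the flat map makes - sharp_w a two-sided inverse.\<close>

lemma sharp_w_form: "\<alpha> \<in> \<Omega> \<Longrightarrow> \<sigma> (sharp A w \<alpha>) = - \<alpha>"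
  by (metis sigma_surj sigma_uminus w(2))

definition tensor_of :: "'m bivector \<Rightarrow> 'm tensor11"
  where "tensor_of W = (\<lambda>X. - sharp A W (\<sigma> X))"

lemma tensor_of_symplectic_tensor:
  assumes W: "W \<in> bivector_fields A"
  shows "symplectic_tensor A \<sigma> (tensor_of W)"
proof
  note [simp] = sigma_one_form sharp(1)[OF W] vector_fields_intros
  show "tensor_of W \<in> tensors11 A"
    unfolding tensors11_def mem_Collect_eq
  proof (intro conjI ballI allI impI)
    fix X assume X: "X \<in> V"
    show "tensor_of W X \<in> V" using X by (simp add: tensor_of_def)
    show "tensor_of W (X + Y) = tensor_of W X + tensor_of W Y" if "Y \<in> V" for Y
      using X that by (simp add: tensor_of_def sigma_add sharp_add[OF W])
    show "tensor_of W (smul f X) = smul f (tensor_of W X)" if "f \<in> C" for f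
      using X that by (simp add: tensor_of_def sigma_smul sharp_smul[OF W])
        (simp add: smul_def fun_eq_iff)
  qed (simp add: tensor_of_def sigma_off sharp_zero[OF W])
  show "\<sigma> (tensor_of W X) Y = \<sigma> X (tensor_of W Y)" if X: "X \<in> V" and Y: "Y \<in> V" for X Y
    using X Y sharp_skew[OF W sigma_one_form[OF X] sigma_one_form[OF Y]]
      sigma_skew[of "sharp A W (\<sigma> X)" Y] one_formD(4)[OF sigma_one_form[OF X], of "sharp A W (\<sigma> Y)"]
    by (simp add: tensor_of_def sigma_uminus)
qed

definition kappa_of :: "'m bivector \<Rightarrow> 'm bivector"
  where "kappa_of W = bivector_of A
    (\<lambda>\<alpha>. - smul (const_fun \<epsilon>) (sharp A w \<alpha>) - sharp A W (\<sigma> (sharp A W \<alpha>)))"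

text \<open>The prescribed entry is the sharp map of - \<epsilon> w plus the pullback of \<sigma>
  under sharp_W, and both summands are skew.\<close>

lemma kappa_of:
  assumes W: "W \<in> bivector_fields A"
  shows "kappa_of W \<in> bivector_fields A"
    and "\<alpha> \<in> \<Omega> \<Longrightarrow> sharp A (kappa_of W) \<alpha> =
      - smul (const_fun \<epsilon>) (sharp A w \<alpha>) - sharp A W (\<sigma> (sharp A W \<alpha>))"
proof -
  let ?K = "\<lambda>\<alpha>. - smul (const_fun \<epsilon>) (sharp A w \<alpha>) - sharp A W (\<sigma> (sharp A W \<alpha>))"
  note [simp] = sigma_one_form sharp(1)[OF W] sharp(1)[OF w(1)] vector_fields_intros
    smooth_functions_const
  have K: "?K \<alpha> \<in> V" if "\<alpha> \<in> \<Omega>" for \<alpha>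
    using that by simp
  have skew: "\<beta> (?K \<alpha>) = - \<alpha> (?K \<beta>)" if \<alpha>: "\<alpha> \<in> \<Omega>" and \<beta>: "\<beta> \<in> \<Omega>" for \<alpha> \<beta>
  proof
    fix p
    \<comment> \<open>Moving the outer sharp_W onto \<eta> changes the sign and leaves \<sigma>
      evaluated on two sharps, visibly skew in \<xi> and \<eta>.\<close>
    have eval: "\<eta> (?K \<xi>) p = - \<epsilon> * \<eta> (sharp A w \<xi>) p + \<sigma> (sharp A W \<xi>) (sharp A W \<eta>) p"
      if "\<xi> \<in> \<Omega>" "\<eta> \<in> \<Omega>" for \<xi> \<eta>
    proof -
      have "\<eta> (?K \<xi>) = - (const_fun \<epsilon> * \<eta> (sharp A w \<xi>)) - \<eta> (sharp A W (\<sigma> (sharp A W \<xi>)))"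
        using that by (simp add: one_form_diff[OF that(2)] one_formD(3,4)[OF that(2)])
      then show ?thesis
        using that fun_cong[OF sharp_skew[OF W sigma_one_form that(2), of "sharp A W \<xi>"], of p]
        by (simp add: const_fun_def)
    qed
    show "\<beta> (?K \<alpha>) p = (- \<alpha> (?K \<beta>)) p"
      using eval[OF \<alpha> \<beta>] eval[OF \<beta> \<alpha>] fun_cong[OF sharp_skew[OF w(1) \<alpha> \<beta>], of p]
        fun_cong[OF sigma_skew[OF sharp(1)[OF W \<alpha>] sharp(1)[OF W \<beta>]], of p]
      by simp
  qed
  show "kappa_of W \<in> bivector_fields A"
    unfolding kappa_of_def using K skew by (rule bivector_of_bivector_field)
  show "\<alpha> \<in> \<Omega> \<Longrightarrow> sharp A (kappa_of W) \<alpha> = ?K \<alpha>"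
    unfolding kappa_of_def using K skew by (rule sharp_bivector_of)
qed

text \<open>A matrix is 0 outside the sections, so its entries matter only on vector fields and
  one-forms.\<close>

lemma big_matrix_cong:
  assumes "\<And>X. X \<in> V \<Longrightarrow> a X = a' X" "\<And>\<alpha>. \<alpha> \<in> \<Omega> \<Longrightarrow> b \<alpha> = b' \<alpha>"
    "\<And>X. X \<in> V \<Longrightarrow> c X = c' X" "\<And>\<alpha>. \<alpha> \<in> \<Omega> \<Longrightarrow> d \<alpha> = d' \<alpha>"
  shows "big_matrix A a b c d = big_matrix A a' b' c' d'"
  using assms by (auto simp: big_matrix_def big_sections_def fun_eq_iff)

text \<open>The content is the lower right entry: skewness of \<open>W\<close> and of \<sigma> makes
  flat o sharp_W the negative transpose of \<open>tensor_of W\<close>.\<close>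

lemma cps_of_poisson_eq:
  assumes W: "W \<in> bivector_fields A"
  shows "cps_of_poisson A \<sigma> w \<epsilon> W = Phi (tensor_of W) (kappa_of W)"
  unfolding cps_of_poisson_def flat_eq
proof (rule big_matrix_cong)
  interpret symplectic_tensor A \<sigma> "tensor_of W" by (rule tensor_of_symplectic_tensor[OF W])
  fix \<alpha> assume \<alpha>: "\<alpha> \<in> \<Omega>"
  show "\<sigma> (sharp A W \<alpha>) = - transpose11 (tensor_of W) \<alpha>"
  proof (rule one_form_eqI[of _ A])
    show "\<sigma> (sharp A W \<alpha>) \<in> \<Omega>" "- transpose11 (tensor_of W) \<alpha> \<in> \<Omega>"
      using \<alpha> by (simp_all add: sigma_one_form sharp(1)[OF W] one_forms_intros transpose11_one_form[OF B])
    fix Y assume Y: "Y \<in> V"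
    note s = sigma_one_form[OF Y]
    show "\<sigma> (sharp A W \<alpha>) Y = (- transpose11 (tensor_of W) \<alpha>) Y"
      using sharp_skew[OF W s \<alpha>] sigma_skew[OF sharp(1)[OF W \<alpha>] Y] one_formD(4)[OF \<alpha> sharp(1)[OF W s]]
      by (simp add: transpose11_def tensor_of_def)
  qed
qed (simp_all add: tensor_of_def kappa_of(2)[OF W])

lemma tensor_of_square:
  assumes W: "W \<in> bivector_fields A" and X: "X \<in> V"
  shows "tensor_of W (tensor_of W X) + sharp A (kappa_of W) (\<sigma> X) = smul (const_fun \<epsilon>) X"
proof -
  have "tensor_of W (tensor_of W X) = sharp A W (\<sigma> (sharp A W (\<sigma> X)))"
    using tensors11D(4)[OF symplectic_tensor.B[OF tensor_of_symplectic_tensor[OF W]], of "sharp A W (\<sigma> X)"]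
      sharp(1)[OF W sigma_one_form[OF X]] by (simp add: tensor_of_def)
  then show ?thesis
    using X by (simp add: kappa_of(2)[OF W] sigma_one_form w(2)) (simp add: fun_eq_iff smul_def)
qed

lemma generalized_cps_iff_poisson:
  assumes W: "W \<in> bivector_fields A"
  shows "generalized_cps A \<epsilon> (cps_of_poisson A \<sigma> w \<epsilon> W) \<longleftrightarrow> poisson A W \<and> schouten_vanishes A w W"
proof -
  interpret symplectic_tensor A \<sigma> "tensor_of W" by (rule tensor_of_symplectic_tensor[OF W])
  note sq = tensor_of_square[OF W]
  have "sharp A W (\<sigma> X) = - tensor_of W X" for X by (simp add: tensor_of_def)
  then have "poisson A W \<and> schouten_vanishes A w W \<longleftrightarrow> integrable_cps A (Phi (tensor_of W) (kappa_of W))"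
    using poisson_compatible_iff[OF w W] integrable_cps_iff[OF kappa_of(1)[OF W] sq] by simp
  moreover have "generalized_almost_cps A \<epsilon> (Phi (tensor_of W) (kappa_of W))"
    using Phi_generalized_almost_cps_iff[OF B kappa_of(1)[OF W]] sq sym by blast
  ultimately show ?thesis unfolding generalized_cps_def cps_of_poisson_eq[OF W] by blast
qed

lemma represented_by_cps_of_poisson:
  assumes W: "W \<in> bivector_fields A"
  shows "represented_by A (cps_of_poisson A \<sigma> w \<epsilon> W) (tensor_of W) (kappa_of W) \<sigma>"
  using symplectic_tensor.B[OF tensor_of_symplectic_tensor[OF W]] kappa_of(1)[OF W] form2
  by (simp add: represented_by_def cps_of_poisson_eq[OF W] two_forms_def)

text \<open>The upper left entry already determines \<open>W\<close>: its value on X is - sharp_W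
  (\<sigma> X), and the \<sigma> X are all the one-forms.\<close>

lemma cps_of_poisson_inj:
  assumes P: "P \<in> bivector_fields A" and Q: "Q \<in> bivector_fields A"
    and eq: "cps_of_poisson A \<sigma> w \<epsilon> P = cps_of_poisson A \<sigma> w \<epsilon> Q"
  shows "P = Q"
proof (rule bivector_eqI[OF P Q])
  fix \<alpha> assume "\<alpha> \<in> \<Omega>"
  then obtain X where X: "X \<in> V" "\<alpha> = \<sigma> X" by (rule sigma_surj)
  have "fst (cps_of_poisson A \<sigma> w \<epsilon> W (X, 0)) = - sharp A W (\<sigma> X)" if "W \<in> bivector_fields A" for W
    unfolding cps_of_poisson_eq[OF that] using X(1)
    by (simp add: Phi_apply one_forms_intros(5) sharp_zero[OF kappa_of(1)[OF that]] tensor_of_def)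
  from this[OF P] this[OF Q] show "sharp A P \<alpha> = sharp A Q \<alpha>" using eq X(2) by simp
qed

lemma generalized_cps_is_cps_of_poisson:
  assumes \<Phi>: "generalized_almost_cps A \<epsilon> \<Phi>" and rep: "represented_by A \<Phi> B \<kappa> \<sigma>"
  shows "\<exists>W\<in>bivector_fields A. \<Phi> = cps_of_poisson A \<sigma> w \<epsilon> W"
proof -
  have B: "B \<in> tensors11 A" and \<kappa>: "\<kappa> \<in> bivector_fields A" and eq: "\<Phi> = Phi B \<kappa>"
    using rep by (simp_all add: represented_by_def)
  have sym: "\<And>X Y. X \<in> V \<Longrightarrow> Y \<in> V \<Longrightarrow> \<sigma> (B X) Y = \<sigma> X (B Y)"
    and sq: "\<And>X. X \<in> V \<Longrightarrow> B (B X) + sharp A \<kappa> (\<sigma> X) = smul (const_fun \<epsilon>) X"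
    using \<Phi> unfolding eq Phi_generalized_almost_cps_iff[OF B \<kappa>] by blast+
  interpret symplectic_tensor A \<sigma> B by standard (rule B, rule sym)
  \<comment> \<open>Solves B = - sharp_W o flat for sharp_W; symmetry of \<open>B\<close> with
    respect to \<sigma> makes the solution skew.\<close>
  let ?K = "\<lambda>\<alpha>. B (sharp A w \<alpha>)"
  define W where "W = bivector_of A ?K"
  have K: "?K \<alpha> \<in> V" if "\<alpha> \<in> \<Omega>" for \<alpha>
    by (rule BV[OF sharp(1)[OF w(1) that]])
  have skew: "\<beta> (?K \<alpha>) = - \<alpha> (?K \<beta>)" if \<alpha>: "\<alpha> \<in> \<Omega>" and \<beta>: "\<beta> \<in> \<Omega>" for \<alpha> \<beta>
  proof -
    let ?a = "sharp A w \<alpha>" and ?b = "sharp A w \<beta>"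
    have V: "?a \<in> V" "?b \<in> V" using sharp(1)[OF w(1)] \<alpha> \<beta> by auto
    have "\<beta> = - \<sigma> ?b" "\<alpha> = - \<sigma> ?a" using sharp_w_form \<alpha> \<beta> by simp_all
    then have "\<beta> (?K \<alpha>) = - \<sigma> ?b (B ?a)" "\<alpha> (?K \<beta>) = - \<sigma> ?a (B ?b)"
      by (metis uminus_apply)+
    then show ?thesis
      by (simp add: sym[OF V(2,1), symmetric] sym[OF V, symmetric] theta_skew[OF V])
  qed
  have W1: "W \<in> bivector_fields A"
    unfolding W_def using K skew by (rule bivector_of_bivector_field)
  have W2: "sharp A W \<alpha> = ?K \<alpha>" if "\<alpha> \<in> \<Omega>" for \<alpha>
    unfolding W_def using K skew that by (rule sharp_bivector_of)
  note W = W1 W2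
  have BW: "sharp A W (\<sigma> X) = - B X" if "X \<in> V" for X
    using that by (simp add: W(2) sigma_one_form w(2) tensors11D(4)[OF B])
  then have tensor: "tensor_of W X = B X" if "X \<in> V" for X
    using that by (simp add: tensor_of_def)
  have "\<Phi> = Phi (tensor_of W) (kappa_of W)"
    unfolding eq
  proof (rule big_matrix_cong)
    fix \<alpha> assume \<alpha>: "\<alpha> \<in> \<Omega>"
    obtain X where X: "X \<in> V" "\<alpha> = \<sigma> X" using sigma_surj[OF \<alpha>] .
    \<comment> \<open>Both sides solve the same equation: added to B (B X) they give \<epsilon>
      X.\<close>
    show "sharp A \<kappa> \<alpha> = sharp A (kappa_of W) \<alpha>"
      using sq[OF X(1)] tensor_of_square[OF W(1) X(1)] X(2)
      by (simp add: tensor X(1) BV) (metis add_left_imp_eq)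
    show "- transpose11 B \<alpha> = - transpose11 (tensor_of W) \<alpha>"
    proof -
      interpret T: symplectic_tensor A \<sigma> "tensor_of W" by (rule tensor_of_symplectic_tensor[OF W(1)])
      have "transpose11 B \<alpha> = \<sigma> (B X)" "transpose11 (tensor_of W) \<alpha> = \<sigma> (tensor_of W X)"
        unfolding X(2) using X(1) by (auto intro: transpose11_sigma[OF B _ sym] transpose11_sigma[OF T.B _ T.sym])
      then show ?thesis by (simp add: tensor X(1))
    qed
  qed (simp_all add: tensor)
  then show ?thesis using cps_of_poisson_eq[OF W(1)] W(1) by metis
qed

end

theorem proposition1p3:
  fixes A :: "('m::{t2_space,second_countable_topology}, 'e::real_normed_vector) atlas"
    and \<sigma> :: "'m form2" and w :: "'m bivector" and \<epsilon> :: real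
  assumes "smooth_manifold A"
    and "symplectic_form A \<sigma>"
    and "poisson_bivector_of A \<sigma> w"
    and "\<epsilon> \<in> {-1, 1, 0}"
  shows "bij_betw (cps_of_poisson A \<sigma> w \<epsilon>)
    {W. poisson A W \<and> schouten_vanishes A w W}
    {\<Phi>. generalized_cps A \<epsilon> \<Phi> \<and> (\<exists>B \<kappa>. represented_by A \<Phi> B \<kappa> \<sigma>)}"
proof -
  interpret symplectic_poisson A \<sigma> w \<epsilon>
    using assms(2,3) by unfold_locales
  have bivector: "W \<in> bivector_fields A" if "poisson A W" for W
    using that by (simp add: poisson_def)
  show ?thesis
  proof (rule bij_betw_imageI)
    show "inj_on (cps_of_poisson A \<sigma> w \<epsilon>) {W. poisson A W \<and> schouten_vanishes A w W}"
      by (auto intro!: inj_onI cps_of_poisson_inj dest: bivector)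
    show "cps_of_poisson A \<sigma> w \<epsilon> ` {W. poisson A W \<and> schouten_vanishes A w W} =
        {\<Phi>. generalized_cps A \<epsilon> \<Phi> \<and> (\<exists>B \<kappa>. represented_by A \<Phi> B \<kappa> \<sigma>)}"
    proof (intro equalityI subsetI)
      fix \<Phi> assume "\<Phi> \<in> cps_of_poisson A \<sigma> w \<epsilon> ` {W. poisson A W \<and> schouten_vanishes A w W}"
      then show "\<Phi> \<in> {\<Phi>. generalized_cps A \<epsilon> \<Phi> \<and> (\<exists>B \<kappa>. represented_by A \<Phi> B \<kappa> \<sigma>)}"
        using bivector generalized_cps_iff_poisson represented_by_cps_of_poisson by blast
    next
      fix \<Phi> assume "\<Phi> \<in> {\<Phi>. generalized_cps A \<epsilon> \<Phi> \<and> (\<exists>B \<kappa>. represented_by A \<Phi> B \<kappa> \<sigma>)}"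
      \<comment> \<open>The almost structure provides \<open>W\<close> as a bivector; its
        integrability then makes \<open>W\<close> Poisson and compatible with
        \<open>w\<close>.\<close>
      then obtain W where "W \<in> bivector_fields A" "\<Phi> = cps_of_poisson A \<sigma> w \<epsilon> W"
          "generalized_cps A \<epsilon> \<Phi>"
        using generalized_cps_is_cps_of_poisson unfolding generalized_cps_def by blast
      then show "\<Phi> \<in> cps_of_poisson A \<sigma> w \<epsilon> ` {W. poisson A W \<and> schouten_vanishes A w W}"
        using generalized_cps_iff_poisson by blast
    qed
  qed
qed

end
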